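(* For any $\alpha\in[0,1)$ and any integer $d\ge1$, $$q_L(\alpha,d,d)\ \le\ \frac{d!\,(1-\alpha)^d}{1+d!\,(1-\alpha)^d}\ \le\ d!\,(1-\alpha)^d .$$
   Context: Setting: site percolation on $\mathbb Z^{d+1}$. $\Omega=\{0,1\}^{\mathbb Z^{d+1}}$, and for $p\in[0,1]$, $\mathbb P_p$ is the product measure on $\Omega$ of Bernoulli distributions with parameter $p$. A site $x$ is open if $\omega(x)=1$ and closed if $\omega(x)=0$. A function $F:\mathbb Z^d\to\mathbb Z$ is Lipschitz if $|F(\bar x)-F(\bar y)|\le 1$ whenever $\Vert\bar x-\bar y\Vert_1=1$. For $\alpha\in[0,1)$ and $\eta\in\{-1,0,+1\}^d$, $\mathsf{LIP}^{\alpha,d}_\eta$ is the event of all $\omega\in\Omega$ for which there is a Lipschitz function $F$ such that for all $\bar x\in\mathbb Z^d$: $\omega((\bar x,F(\bar x)))=1$ and $F(\bar x)>\lfloor\alpha\sum_{i=1}^d\eta_i\bar x_i\rfloor$. Critical probability: there is a number $p_L(\alpha,d,\eta)\in(0,1)$ such that $\mathbb P_p(\mathsf{LIP}^{\alpha,d}_\eta)=0$ for $p<p_L(\alpha,d,\eta)$ and $=1$ for $p>p_L(\alpha,d,\eta)$; it depends on $\eta$ only through $k=\Vert\eta\Vert_1\in\{0,\dots,d\}$ and is written $p_L(\alpha,d,k)$. Put $q_L(\alpha,d,k):=1-p_L(\alpha,d,k)$. *)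

theory Defs
  imports "HOL-Probability.Probability"
begin

text \<open>
  The dimension \<open>d\<close> is \<open>CARD('d)\<close>; a site of \<open>\<int>\<^sup>d\<^sup>+\<^sup>1\<close> is a pair of a base point in
  \<open>\<int>\<^sup>d\<close> and a height. The values \<open>1\<close> (open) and \<open>0\<close> (closed) of a configuration are
  \<open>True\<close> and \<open>False\<close>.
\<close>

type_synonym 'd site = "(int ^ 'd) \<times> int"
type_synonym 'd config = "'d site \<Rightarrow> bool"

definition l1_norm :: "int ^ 'd::finite \<Rightarrow> int" where
  "l1_norm x = (\<Sum>i\<in>UNIV. \<bar>x $ i\<bar>)"

definition lipschitz_fun :: "(int ^ 'd::finite \<Rightarrow> int) \<Rightarrow> bool" where
  "lipschitz_fun F \<longleftrightarrow> (\<forall>x y. l1_norm (x - y) = 1 \<longrightarrow> \<bar>F x - F y\<bar> \<le> 1)"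

definition perc :: "real \<Rightarrow> ('d::finite) config measure" where
  "perc p = PiM UNIV (\<lambda>_. measure_pmf (bernoulli_pmf p))"

definition LIP :: "real \<Rightarrow> int ^ 'd::finite \<Rightarrow> 'd config set" where
  "LIP \<alpha> \<eta> = {\<omega>. \<exists>F. lipschitz_fun F \<and>
     (\<forall>x. \<omega> (x, F x) \<and> F x > \<lfloor>\<alpha> * real_of_int (\<Sum>i\<in>UNIV. \<eta> $ i * x $ i)\<rfloor>)}"

definition is_critical :: "real \<Rightarrow> int ^ 'd::finite \<Rightarrow> real \<Rightarrow> bool" where
  "is_critical \<alpha> \<eta> c \<longleftrightarrow> 0 < c \<and> c < 1 \<and>
     (\<forall>p\<in>{0..1}. (p < c \<longrightarrow> measure (perc p) (LIP \<alpha> \<eta>) = 0) \<and>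
                 (p > c \<longrightarrow> measure (perc p) (LIP \<alpha> \<eta>) = 1))"

text \<open>
  The critical probability is indexed by the direction \<open>\<eta>\<close> itself, not by \<open>k = l1_norm \<eta>\<close>;
  \<open>p\<^sub>L(\<alpha>, d, k)\<close> is \<open>p_L \<alpha> \<eta>\<close> for any \<open>\<eta> \<in> {-1,0,1}\<^sup>d\<close> with \<open>l1_norm \<eta> = k\<close>.
\<close>

definition p_L :: "real \<Rightarrow> int ^ 'd::finite \<Rightarrow> real" where
  "p_L \<alpha> \<eta> = (THE c. is_critical \<alpha> \<eta> c)"

definition q_L :: "real \<Rightarrow> int ^ 'd::finite \<Rightarrow> real" where
  "q_L \<alpha> \<eta> = 1 - p_L \<alpha> \<eta>"

end

theory Submission
  imports Defs
begin

text \<open>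
  The event \<open>LIP\<close> asks for an open Lipschitz surface above the tilted plane of slope
  \<open>\<alpha> \<eta>\<close>. A surface is obstructed by upward progress through closed sites: if it lies strictly
  above a site, then it also lies strictly above every site reached by a diagonal step down (it is
  Lipschitz), and above the site one step up when that site is closed (it avoids closed sites). So
  a walk of such steps started on or below the plane stays below every admissible surface, and
  conversely the envelope of all such walks, if finite, is an admissible surface
  (\<open>lip_above_iff\<close>).

  The upper bound on \<open>q_L\<close> comes from a greedy walk. From \<open>(x, h)\<close> it examines the sites
  \<open>(x - e, h + 1 - \<bar>e\<bar>)\<close>, where \<open>e\<close> runs through the vectors with coordinates of the signs of
  \<open>\<eta>\<close>, in order of nondecreasing length \<open>\<bar>e\<bar>\<close>, until it finds a closed one. Going there costs
  \<open>\<bar>e\<bar>\<close> diagonal steps, each of which loses \<open>1 - \<alpha>\<close> relative to the plane, and gains one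
  upward step. Every round examines a fresh hyperplane, so the ranks of the closed sites found are
  independent geometric variables with mean \<open>p / q\<close>, where \<open>q = 1 - p\<close>. The simplex of vectors
  shorter than \<open>N\<close> has at least \<open>N^d / d!\<close> points, hence \<open>\<bar>e\<bar>^d \<le> d! r\<close> for rank \<open>r\<close>, and by
  convexity the mean of \<open>\<bar>e\<bar>\<close> is at most \<open>(d! p / q) powr (1 / d)\<close>. If
  \<open>d! (1 - \<alpha>)^d p < q\<close>, this is below \<open>1 / (1 - \<alpha>)\<close> and the walk gains height on average. Markov's
  inequality for the total rank turns this into a gain with positive probability. As the surface must be pushed up over one given point, the end of the
  walk is located by the pigeonhole principle in one of boundedly many boxes and the start is
  chosen accordingly (\<open>greedy_events_push_up\<close>). With a probability bounded away from \<open>0\<close>,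
  every admissible surface therefore exceeds any given height over the origin, so that \<open>LIP\<close> does
  not have probability one.

  Since \<open>p_L\<close> is defined by a description, the existence of the critical value is part of
  the proof. The zero-one law (\<open>lip_above_zero_one\<close>) holds because raising the plane
  preserves the probability, while the event that surfaces exist above all raised planes is a tail
  event. Monotonicity (\<open>lip_above_mono\<close>) is a coupling. A density \<open>p < 1\<close> at which the event
  has probability one (\<open>supercritical_exists\<close>) is found by counting walks without repeated
  sites: a walk that climbs above the plane spends a fixed fraction of its steps on distinct closed
  sites. The greedy walk gives probability zero for all \<open>p\<close> with \<open>p (1 + d! (1 - \<alpha>)^d) < 1\<close>,
  and this is the asserted bound.
\<close>

section \<open>The percolation measure\<close>

lemma space_perc [simp]: "space (perc p) = UNIV"
  by (simp add: perc_def space_PiM)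

lemma prob_space_perc: "prob_space (perc p)"
  unfolding perc_def by (intro prob_space_PiM) (simp add: measure_pmf.prob_space_axioms)

lemma site_measurable [measurable]: "(\<lambda>\<omega>. \<omega> v) \<in> measurable (perc p) (count_space UNIV)"
  using measurable_component_singleton[of v UNIV "\<lambda>_. measure_pmf (bernoulli_pmf p)"]
  unfolding perc_def by simp

lemma open_site_sets [measurable]: "{\<omega>. \<omega> v} \<in> sets (perc p)"
proof -
  have "{\<omega> \<in> space (perc p). \<omega> v} \<in> sets (perc p)" by measurable
  then show ?thesis by simp
qed

lemma perc_cylinder:
  assumes "finite A" "finite B" "A \<inter> B = {}" "0 \<le> p" "p \<le> 1"
  shows "measure (perc p) {\<omega>. (\<forall>v\<in>A. \<omega> v) \<and> (\<forall>v\<in>B. \<not> \<omega> v)} = p ^ card A * (1 - p) ^ card B"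
proof -
  interpret product_prob_space "\<lambda>_. measure_pmf (bernoulli_pmf p)" "UNIV :: 'a site set"
    by unfold_locales
  let ?X = "\<lambda>v. if v \<in> A then {True} else {False}"
  have "{\<omega>. (\<forall>v\<in>A. \<omega> v) \<and> (\<forall>v\<in>B. \<not> \<omega> v)} =
      {\<omega> \<in> space (perc p). \<forall>v\<in>A \<union> B. \<omega> v \<in> ?X v}"
    using assms(3) by (auto split: if_splits)
  then have "emeasure (perc p) {\<omega>. (\<forall>v\<in>A. \<omega> v) \<and> (\<forall>v\<in>B. \<not> \<omega> v)}
      = (\<Prod>v\<in>A \<union> B. emeasure (measure_pmf (bernoulli_pmf p)) (?X v))"
    using emeasure_PiM_Collect[of "A \<union> B" ?X] assms(1,2) unfolding perc_def by simp
  also have "\<dots> = ennreal (\<Prod>v\<in>A \<union> B. measure (measure_pmf (bernoulli_pmf p)) (?X v))"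
    by (simp only: measure_pmf.emeasure_eq_measure prod_ennreal[OF measure_nonneg])
  finally have "measure (perc p) {\<omega>. (\<forall>v\<in>A. \<omega> v) \<and> (\<forall>v\<in>B. \<not> \<omega> v)}
      = (\<Prod>v\<in>A \<union> B. measure (measure_pmf (bernoulli_pmf p)) (?X v))"
    by (simp add: measure_def prod_nonneg)
  also have "\<dots> = (\<Prod>v\<in>A. measure (measure_pmf (bernoulli_pmf p)) (?X v))
      * (\<Prod>v\<in>B. measure (measure_pmf (bernoulli_pmf p)) (?X v))"
    using assms by (intro prod.union_disjoint) auto
  also have "(\<Prod>v\<in>A. measure (measure_pmf (bernoulli_pmf p)) (?X v)) = (\<Prod>v\<in>A. p)"
    using assms by (intro prod.cong) (auto simp: measure_pmf_single)
  also have "(\<Prod>v\<in>B. measure (measure_pmf (bernoulli_pmf p)) (?X v)) = (\<Prod>v\<in>B. 1 - p)"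
    using assms by (intro prod.cong) (auto simp: measure_pmf_single)
  finally show ?thesis by simp
qed

section \<open>Surfaces and walks\<close>

text \<open>
  The plane is replaced by an arbitrary function of the base point, so that it can be raised by a
  constant in the zero-one law.
\<close>

definition lip_above :: "(int ^ 'd::finite \<Rightarrow> int) \<Rightarrow> 'd config set" where
  "lip_above b = {\<omega>. \<exists>F. lipschitz_fun F \<and> (\<forall>x. \<omega> (x, F x) \<and> F x > b x)}"

text \<open>
  A surface that lies strictly above the start of such a step also lies strictly above its end,
  provided that a step up ends at a closed site.
\<close>

definition steps :: "'d::finite site set" where
  "steps = insert (0, 1) ({z. l1_norm z = 1} \<times> {-1})"

text \<open>
  Walks are read from their end point \<open>v\<close> back to a start on or below the graph of \<open>b\<close>. Steps
  up are confined to sites above that graph: then the event that \<open>v\<close> can be reached depends on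
  no site on or below it, which makes it fit for a tail event.
\<close>

primrec walk :: "(int ^ 'd::finite \<Rightarrow> int) \<Rightarrow> 'd config \<Rightarrow> 'd site \<Rightarrow> 'd site list \<Rightarrow> bool" where
  "walk b \<omega> v [] \<longleftrightarrow> snd v \<le> b (fst v)"
| "walk b \<omega> v (s # ws) \<longleftrightarrow>
     s \<in> steps \<and> (s = (0, 1) \<longrightarrow> \<not> \<omega> v \<and> snd v > b (fst v)) \<and> walk b \<omega> (v - s) ws"

definition reach :: "(int ^ 'd::finite \<Rightarrow> int) \<Rightarrow> 'd config \<Rightarrow> 'd site \<Rightarrow> bool" where
  "reach b \<omega> v \<longleftrightarrow> (\<exists>ws. walk b \<omega> v ws)"

text \<open>
  A surface above the graph of \<open>b\<close> stays above every walk: a diagonal step is absorbed by the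
  Lipschitz property, and a step up ends at a closed site, which the surface must avoid.
\<close>

lemma lipschitz_above_walk:
  assumes F: "lipschitz_fun F" "\<And>x. \<omega> (x, F x)" "\<And>x. F x > b x"
  shows "walk b \<omega> v ws \<Longrightarrow> snd v < F (fst v)"
proof (induction ws arbitrary: v)
  case Nil
  then show ?case using F(3)[of "fst v"] by simp
next
  case (Cons s ws)
  have IH: "snd (v - s) < F (fst (v - s))" using Cons.prems by (intro Cons.IH) simp
  show ?case
  proof (cases "s = (0, 1)")
    case True
    then have "\<not> \<omega> v" using Cons.prems by simp
    then have "F (fst v) \<noteq> snd v" using F(2)[of "fst v"] by (metis prod.collapse)
    with IH True show ?thesis by simp
  next
    case False
    then obtain z where z: "s = (z, -1)" "l1_norm z = 1"
      using Cons.prems by (auto simp: steps_def)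
    have "\<bar>F (fst v) - F (fst v - z)\<bar> \<le> 1"
      using F(1) z(2) unfolding lipschitz_fun_def by simp
    with IH z show ?thesis by simp
  qed
qed

text \<open>
  If over each base point the reachable heights are bounded, then the surface one above the highest
  reachable sites is admissible. It is open, since otherwise a further step up would be possible,
  and Lipschitz, since reachability is preserved by diagonal steps.
\<close>

lemma lip_above_iff:
  "\<omega> \<in> lip_above b \<longleftrightarrow> (\<forall>x. \<exists>H. \<forall>h\<ge>H. \<not> reach b \<omega> (x, h))"
proof
  assume "\<omega> \<in> lip_above b"
  then obtain F where "lipschitz_fun F" "\<And>x. \<omega> (x, F x)" "\<And>x. F x > b x"
    unfolding lip_above_def by auto
  then have "h < F x" if "reach b \<omega> (x, h)" for x h
    using lipschitz_above_walk[of F \<omega> b "(x, h)"] that unfolding reach_def by auto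
  then show "\<forall>x. \<exists>H. \<forall>h\<ge>H. \<not> reach b \<omega> (x, h)"
    by (meson leD)
next
  assume *: "\<forall>x. \<exists>H. \<forall>h\<ge>H. \<not> reach b \<omega> (x, h)"
  have "\<exists>h. reach b \<omega> (x, h) \<and> (\<forall>k>h. \<not> reach b \<omega> (x, k))" for x
  proof -
    obtain H where H: "\<forall>h\<ge>H. \<not> reach b \<omega> (x, h)" using * by blast
    let ?S = "{h. b x \<le> h \<and> reach b \<omega> (x, h)}"
    have "?S \<subseteq> {b x..H}" using H by auto (meson linorder_le_cases)
    then have fin: "finite ?S" using finite_subset by blast
    have "reach b \<omega> (x, b x)" unfolding reach_def by (rule exI[of _ "[]"]) simp
    then have ne: "b x \<in> ?S" by simp
    have "Max ?S \<in> ?S" using fin ne Max_in by blast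
    moreover have "\<not> reach b \<omega> (x, k)" if "k > Max ?S" for k
    proof
      assume "reach b \<omega> (x, k)"
      moreover have "b x \<le> k" using Max_ge[OF fin ne] that by simp
      ultimately have "k \<le> Max ?S" using fin by (intro Max_ge) auto
      with that show False by simp
    qed
    ultimately show ?thesis by blast
  qed
  then obtain M where M: "\<And>x. reach b \<omega> (x, M x)" "\<And>x k. k > M x \<Longrightarrow> \<not> reach b \<omega> (x, k)"
    by metis
  define F where "F x = M x + 1" for x
  have below: "b x \<le> M x" for x
  proof (rule ccontr)
    assume "\<not> b x \<le> M x"
    moreover have "reach b \<omega> (x, b x)" unfolding reach_def by (rule exI[of _ "[]"]) simp
    ultimately show False using M(2)[of x "b x"] by simp
  qed
  have "\<omega> (x, F x)" for x
  proof (rule ccontr)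
    assume c: "\<not> \<omega> (x, F x)"
    obtain ws where "walk b \<omega> (x, M x) ws" using M(1) unfolding reach_def by blast
    then have "walk b \<omega> (x, F x) ((0, 1) # ws)"
      using c below[of x] by (simp add: F_def steps_def)
    then show False using M(2)[of x "F x"] unfolding reach_def F_def by fastforce
  qed
  moreover have "F x > b x" for x using below[of x] by (simp add: F_def)
  moreover have "lipschitz_fun F"
  proof -
    have step: "M y \<ge> M x - 1" if "l1_norm (y - x) = 1" for x y
    proof -
      obtain ws where "walk b \<omega> (x, M x) ws" using M(1) unfolding reach_def by blast
      then have "walk b \<omega> (y, M x - 1) ((y - x, -1) # ws)"
        using that by (simp add: steps_def)
      then have "reach b \<omega> (y, M x - 1)" unfolding reach_def by blast
      then show ?thesis using M(2)[of y "M x - 1"] by force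
    qed
    have sym: "l1_norm (x - y) = l1_norm (y - x)" for x y :: "int ^ 'a"
      unfolding l1_norm_def by (simp add: abs_minus_commute)
    show ?thesis
      unfolding lipschitz_fun_def F_def using step sym by (smt (verit))
  qed
  ultimately show "\<omega> \<in> lip_above b" unfolding lip_above_def by auto
qed

text \<open>
  By the previous lemma, the existence of a surface, a quantification over an uncountable set of
  functions, becomes a countable combination of conditions on finitely many sites. The \<open>\<sigma>\<close>-algebra
  is left open because the zero-one law needs the one generated by the sites outside a finite set.
\<close>

lemma sets_lip_above:
  assumes N: "space N = UNIV" "\<And>v. snd v > b (fst v) \<Longrightarrow> {\<omega>. \<omega> v} \<in> sets N"
  shows "lip_above b \<in> sets N"
proof -
  have w: "Measurable.pred N (\<lambda>\<omega>. walk b \<omega> v ws)" for v ws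
  proof (induction ws arbitrary: v)
    case Nil
    show ?case by simp
  next
    case (Cons s ws)
    note Cons[measurable]
    have "Measurable.pred N (\<lambda>\<omega>. \<omega> v \<and> snd v > b (fst v))"
      using N(2)[of v] by (cases "snd v > b (fst v)") (auto simp: pred_def N(1))
    then have [measurable]: "Measurable.pred N (\<lambda>\<omega>. \<not> \<omega> v \<and> snd v > b (fst v))"
      by (cases "snd v > b (fst v)") (auto intro: pred_intros_logic)
    show ?case by simp
  qed
  have "Measurable.pred N (\<lambda>\<omega>. \<forall>x. \<exists>H. \<forall>h. H \<le> h \<longrightarrow> \<not> (\<exists>ws. walk b \<omega> (x, h) ws))"
    using w by measurable
  then have "{\<omega> \<in> space N. \<forall>x. \<exists>H. \<forall>h. H \<le> h \<longrightarrow> \<not> (\<exists>ws. walk b \<omega> (x, h) ws)} \<in> sets N"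
    by (rule predE)
  moreover have "lip_above b = {\<omega> \<in> space N. \<forall>x. \<exists>H. \<forall>h. H \<le> h \<longrightarrow> \<not> (\<exists>ws. walk b \<omega> (x, h) ws)}"
    using N(1) lip_above_iff[of _ b] unfolding reach_def by auto
  ultimately show ?thesis by simp
qed

lemma lip_above_sets_perc [measurable]: "lip_above b \<in> sets (perc p)"
  by (intro sets_lip_above) (auto)

definition plane :: "real \<Rightarrow> int ^ 'd::finite \<Rightarrow> int ^ 'd \<Rightarrow> int" where
  "plane \<alpha> \<eta> x = \<lfloor>\<alpha> * real_of_int (\<Sum>i\<in>UNIV. \<eta> $ i * x $ i)\<rfloor>"

lemma LIP_eq_lip_above: "LIP \<alpha> \<eta> = lip_above (plane \<alpha> \<eta>)"
  unfolding LIP_def lip_above_def plane_def ..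

section \<open>The zero-one law\<close>

text \<open>
  The states of the sites, listed along an enumeration, are independent, and the hypothesis says
  that \<open>X\<close> is in the tail of this sequence, so Kolmogorov's law applies.
\<close>

lemma perc_tail_zero_one:
  assumes p: "0 \<le> p" "p \<le> 1"
    and X: "\<And>S. finite S \<Longrightarrow> X \<in> sigma_sets UNIV {{\<omega>. \<omega> v} |v. v \<notin> (S :: 'd::finite site set)}"
  shows "measure (perc p) X = 0 \<or> measure (perc p) X = 1"
proof -
  interpret prob_space "perc p :: 'd config measure" by (rule prob_space_perc)
  have "infinite (UNIV :: 'd site set)"
  proof
    assume "finite (UNIV :: 'd site set)"
    then have "finite (range (\<lambda>h :: int. (0 :: int ^ 'd, h)))" by (rule finite_subset[OF subset_UNIV])
    then have "finite (UNIV :: int set)" by (rule finite_imageD) (simp add: inj_on_def)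
    then show False by simp
  qed
  then obtain e :: "nat \<Rightarrow> 'd site" where e: "bij e"
    using bij_betw_from_nat_into[OF countableI_type] by blast
  define A where "A i = {\<omega> :: 'd config. \<omega> (e i)}" for i
  have A_sets: "A i \<in> sets (perc p)" for i unfolding A_def by simp
  have indep: "indep_events A UNIV"
    unfolding indep_events_def
  proof (intro conjI allI impI)
    show "A ` UNIV \<subseteq> events" using A_sets by auto
    fix J :: "nat set" assume J: "finite J" "J \<noteq> {}"
    have 1: "prob (A i) = p" for i
      using perc_cylinder[of "{e i}" "{}" p] p unfolding A_def by simp
    have "(\<Inter>i\<in>J. A i) = {\<omega>. (\<forall>v\<in>e ` J. \<omega> v) \<and> (\<forall>v\<in>{}. \<not> \<omega> v)}" unfolding A_def by auto
    moreover have "card (e ` J) = card J" using e by (intro card_image) (meson bij_is_inj inj_on_subset subset_UNIV)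
    ultimately show "prob (\<Inter>i\<in>J. A i) = (\<Prod>i\<in>J. prob (A i))"
      using perc_cylinder[of "e ` J" "{}" p] p J 1 by simp
  qed
  have "indep_sets (\<lambda>i. sigma_sets (space (perc p)) {A i}) UNIV"
  proof (rule indep_sets_sigma)
    show "indep_sets (\<lambda>i. {A i}) UNIV" using indep by (simp add: indep_events_def_alt)
    show "Int_stable {A i}" for i unfolding Int_stable_def by simp
  qed
  moreover have "sigma_algebra (space (perc p)) (sigma_sets (space (perc p)) {A i})" for i
    by (intro sigma_algebra_sigma_sets) simp
  moreover have "X \<in> tail_events (\<lambda>i. sigma_sets (space (perc p)) {A i})"
    unfolding tail_events_def
  proof
    fix n
    let ?T = "sigma_sets (space (perc p)) (\<Union>i\<in>{n..}. sigma_sets (space (perc p)) {A i})"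
    have "X \<in> sigma_sets UNIV {{\<omega>. \<omega> v} |v. v \<notin> e ` {..<n}}" by (rule X) simp
    moreover have "{{\<omega>. \<omega> v} |v. v \<notin> e ` {..<n}} \<subseteq> (\<Union>i\<in>{n..}. sigma_sets (space (perc p)) {A i})"
    proof clarify
      fix x h assume v: "(x, h) \<notin> e ` {..<n}"
      obtain i where i: "(x, h) = e i" using e by (metis bij_pointE)
      with v have "n \<le> i" by (metis imageI lessThan_iff not_le)
      moreover have "{\<omega>. \<omega> (x, h)} \<in> sigma_sets (space (perc p)) {A i}"
        unfolding i by (rule sigma_sets.Basic) (simp add: A_def)
      ultimately show "{\<omega>. \<omega> (x, h)} \<in> (\<Union>i\<in>{n..}. sigma_sets (space (perc p)) {A i})" by auto
    qed
    ultimately show "X \<in> ?T"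
      using sigma_sets_mono'[of "{{\<omega>. \<omega> v} |v. v \<notin> e ` {..<n}}"
          "\<Union>i\<in>{n..}. sigma_sets (space (perc p)) {A i}" UNIV]
      unfolding space_perc by (meson subsetD)
  qed
  ultimately show ?thesis by (intro kolmogorov_0_1_law)
qed

lemma vertical_shift_perc:
  "distr (perc p) (perc p) (\<lambda>\<omega> v. \<omega> (fst v, snd v + (h::int))) = (perc p :: 'd::finite config measure)"
proof -
  let ?f = "\<lambda>v :: 'd site. (fst v, snd v + h)"
  have "inj ?f" by (auto simp: inj_on_def prod_eq_iff)
  then show ?thesis
    using distr_PiM_reindex[of UNIV "\<lambda>_. measure_pmf (bernoulli_pmf p)" ?f UNIV]
    unfolding perc_def by (simp add: measure_pmf.prob_space_axioms restrict_def)
qed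

text \<open>
  A vertical translation of the configuration preserves the measure.
\<close>

lemma lip_above_raise:
  "measure (perc p) (lip_above (\<lambda>x. b x + h)) = measure (perc p) (lip_above b)"
proof -
  let ?T = "\<lambda>\<omega> v. \<omega> (fst v, snd v + (h::int))"
  have T: "?T \<in> measurable (perc p) (perc p)"
    unfolding perc_def
    by (rule measurable_PiM_single') (use site_measurable[unfolded perc_def] in \<open>auto simp: space_PiM\<close>)
  have "?T -` lip_above b = lip_above (\<lambda>x. b x + h)"
  proof (intro equalityI subsetI)
    fix \<omega> assume "\<omega> \<in> ?T -` lip_above b"
    then obtain F where "lipschitz_fun F" "\<And>x. \<omega> (x, F x + h) \<and> F x > b x"
      unfolding lip_above_def by auto
    then show "\<omega> \<in> lip_above (\<lambda>x. b x + h)"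
      unfolding lip_above_def lipschitz_fun_def by (intro CollectI exI[of _ "\<lambda>x. F x + h"]) auto
  next
    fix \<omega> assume "\<omega> \<in> lip_above (\<lambda>x. b x + h)"
    then obtain F where "lipschitz_fun F" "\<And>x. \<omega> (x, F x) \<and> F x > b x + h"
      unfolding lip_above_def by auto
    then show "\<omega> \<in> ?T -` lip_above b"
      unfolding lip_above_def lipschitz_fun_def
      by (intro vimageI2 CollectI exI[of _ "\<lambda>x. F x - h"]) (auto simp: algebra_simps)
  qed
  then have "measure (distr (perc p) (perc p) ?T) (lip_above b) = measure (perc p) (lip_above (\<lambda>x. b x + h))"
    using measure_distr[OF T, of "lip_above b"] by simp
  then show ?thesis by (simp add: vertical_shift_perc)
qed

text \<open>
  The events \<open>E n\<close> that there is a surface above the graph raised by \<open>n\<close> decrease and have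
  equal probabilities, so their intersection has the probability of \<open>E 0\<close>. The intersection is a
  tail event: any finite set of sites lies on or below a raised graph and does not affect \<open>E n\<close> for
  large \<open>n\<close>.
\<close>

theorem lip_above_zero_one:
  fixes b :: "int ^ 'd::finite \<Rightarrow> int"
  assumes p: "0 \<le> p" "p \<le> 1"
  shows "measure (perc p) (lip_above b) = 0 \<or> measure (perc p) (lip_above b) = 1"
proof -
  interpret prob_space "perc p :: 'd config measure" by (rule prob_space_perc)
  define E where "E n = lip_above (\<lambda>x. b x + int n)" for n
  have decr: "decseq E"
  proof (rule decseq_SucI, rule subsetI)
    fix n \<omega> assume "\<omega> \<in> E (Suc n)"
    then obtain F where "lipschitz_fun F" "\<And>x. \<omega> (x, F x) \<and> F x > b x + int (Suc n)"
      unfolding E_def lip_above_def by auto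
    moreover from this(2) have "F x > b x + int n" for x by (smt (verit) of_nat_Suc)
    ultimately show "\<omega> \<in> E n" unfolding E_def lip_above_def by auto
  qed
  have Esets: "E n \<in> events" for n unfolding E_def by simp
  have "(\<lambda>n. prob (E n)) \<longlonglongrightarrow> prob (\<Inter>n. E n)"
    using decr Esets by (intro finite_Lim_measure_decseq) auto
  moreover have "prob (E n) = prob (lip_above b)" for n
    unfolding E_def by (rule lip_above_raise)
  ultimately have eq: "prob (\<Inter>n. E n) = prob (lip_above b)"
    by (simp add: LIMSEQ_const_iff)
  have "prob (\<Inter>n. E n) = 0 \<or> prob (\<Inter>n. E n) = 1"
  proof (rule perc_tail_zero_one[OF p])
    fix S :: "'d site set" assume S: "finite S"
    let ?G = "{{\<omega>. \<omega> v} |v. v \<notin> S}"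
    let ?N = "sigma UNIV ?G"
    have N: "space ?N = UNIV" "sets ?N = sigma_sets UNIV ?G" by simp_all
    obtain m where m: "\<And>v. v \<in> S \<Longrightarrow> snd v - b (fst v) \<le> int m"
    proof -
      have "bdd_above ((\<lambda>v. snd v - b (fst v)) ` S)" using S by simp
      then obtain M where "\<And>v. v \<in> S \<Longrightarrow> snd v - b (fst v) \<le> M" unfolding bdd_above_def by auto
      then show thesis by (intro that[of "nat M"]) fastforce
    qed
    have "E n \<in> sets ?N" if "n \<ge> m" for n
      unfolding E_def
    proof (rule sets_lip_above)
      show "{\<omega>. \<omega> v} \<in> sets ?N" if "snd v > b (fst v) + int n" for v
      proof -
        have "v \<notin> S" using m[of v] that \<open>n \<ge> m\<close> by auto
        then have "{\<omega>. \<omega> v} \<in> ?G" by blast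
        then show ?thesis unfolding N by (rule sigma_sets.Basic)
      qed
    qed simp
    then have "(\<Inter>n\<in>{m..}. E n) \<in> sets ?N" by (intro sets.countable_INT') auto
    moreover have "(\<Inter>n\<in>{m..}. E n) = (\<Inter>n. E n)"
    proof
      show "(\<Inter>n\<in>{m..}. E n) \<subseteq> (\<Inter>n. E n)"
      proof (rule INT_greatest)
        fix n
        have "(\<Inter>n\<in>{m..}. E n) \<subseteq> E (max m n)" by (rule INT_lower) simp
        also have "\<dots> \<subseteq> E n" using decr by (simp add: decseqD)
        finally show "(\<Inter>n\<in>{m..}. E n) \<subseteq> E n" .
      qed
    qed auto
    ultimately show "(\<Inter>n. E n) \<in> sigma_sets UNIV ?G" unfolding N by simp
  qed
  then show ?thesis unfolding eq .
qed

section \<open>Monotonicity in the density of open sites\<close>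

text \<open>
  Used for couplings: several percolation measures are images of one product measure under maps
  acting site by site.
\<close>

lemma distr_PiM_map_pmf:
  "distr (PiM UNIV (\<lambda>_::'s. measure_pmf P)) (PiM UNIV (\<lambda>_. measure_pmf (map_pmf f P))) (\<lambda>\<omega> v. f (\<omega> v))
     = PiM UNIV (\<lambda>_. measure_pmf (map_pmf f P))"
    (is "distr ?P ?Q ?T = ?Q")
proof -
  interpret P: product_prob_space "\<lambda>_::'s. measure_pmf P" UNIV by unfold_locales
  interpret Q: product_prob_space "\<lambda>_::'s. measure_pmf (map_pmf f P)" UNIV by unfold_locales
  have T: "?T \<in> measurable ?P ?Q"
  proof (rule measurable_PiM_single')
    fix i :: 's
    have "(\<lambda>\<omega>. \<omega> i) \<in> measurable ?P (measure_pmf P)" by (rule measurable_component_singleton) simp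
    then show "(\<lambda>\<omega>. f (\<omega> i)) \<in> measurable ?P (measure_pmf (map_pmf f P))"
      by (rule measurable_compose) simp
  qed (simp add: space_PiM)
  show ?thesis
  proof (rule Q.PiM_eq)
    fix J :: "'s set" and F assume J: "finite J" "J \<subseteq> UNIV"
      and F: "\<And>j. j \<in> J \<Longrightarrow> F j \<in> sets (measure_pmf (map_pmf f P))"
    let ?X = "prod_emb UNIV (\<lambda>_. measure_pmf (map_pmf f P)) J (Pi\<^sub>E J F)"
    have "?X \<in> sets ?Q" using J F by (intro sets_PiM_I) auto
    moreover have "?T -` ?X \<inter> space ?P = prod_emb UNIV (\<lambda>_. measure_pmf P) J (\<Pi>\<^sub>E j\<in>J. f -` F j)"
      by (auto simp: prod_emb_def space_PiM PiE_iff)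
    ultimately have "emeasure (distr ?P ?Q ?T) ?X = (\<Prod>j\<in>J. emeasure (measure_pmf P) (f -` F j))"
      using J T P.emeasure_PiM_emb[of J "\<lambda>j. f -` F j"] by (simp add: emeasure_distr)
    then show "emeasure (distr ?P ?Q ?T) ?X = (\<Prod>j\<in>J. emeasure (measure_pmf (map_pmf f P)) (F j))"
      by simp
  qed simp
qed

text \<open>
  A site is open at density \<open>p\<close> if it is open at density \<open>p'\<close> and survives an independent
  thinning with parameter \<open>p / p'\<close>. Opening further sites keeps a surface admissible.
\<close>

theorem lip_above_mono:
  fixes b :: "int ^ 'd::finite \<Rightarrow> int"
  assumes p: "0 \<le> p" "p \<le> p'" "p' \<le> 1"
  shows "measure (perc p) (lip_above b) \<le> measure (perc p') (lip_above b)"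
proof (cases "p' = 0")
  case True
  then show ?thesis using p by simp
next
  case False
  then have r: "0 \<le> p / p'" "p / p' \<le> 1" using p by auto
  define J where "J = pair_pmf (bernoulli_pmf p') (bernoulli_pmf (p / p'))"
  have fst: "map_pmf fst J = bernoulli_pmf p'" unfolding J_def by (rule map_fst_pair_pmf)
  have snd: "map_pmf (\<lambda>(x, y). x \<and> y) J = bernoulli_pmf p"
  proof -
    have "pmf (map_pmf (\<lambda>(x, y). x \<and> y) J) True = pmf J (True, True)"
    proof -
      have "(\<lambda>(x, y). x \<and> y) -` {True} = {(True, True)}" by auto
      then show ?thesis by (simp add: pmf_map measure_pmf_single)
    qed
    also have "\<dots> = p" unfolding J_def using r p False by (simp add: pmf_pair)
    finally have 1: "pmf (map_pmf (\<lambda>(x, y). x \<and> y) J) True = p" .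
    show ?thesis
    proof (rule pmf_eqI)
      fix i :: bool
      show "pmf (map_pmf (\<lambda>(x, y). x \<and> y) J) i = pmf (bernoulli_pmf p) i"
        using 1 p pmf_False_conv_True[of "map_pmf (\<lambda>(x, y). x \<and> y) J"] by (cases i) simp_all
    qed
  qed
  let ?M = "PiM UNIV (\<lambda>_ :: 'd site. measure_pmf J)"
  interpret M: prob_space ?M by (intro prob_space_PiM) (simp add: measure_pmf.prob_space_axioms)
  have m: "(\<lambda>\<omega> v. f (\<omega> v)) \<in> measurable ?M (PiM UNIV (\<lambda>_. measure_pmf (map_pmf f J)))" for f :: "_ \<Rightarrow> bool"
  proof (rule measurable_PiM_single')
    fix i :: "'d site"
    have "(\<lambda>\<omega>. \<omega> i) \<in> measurable ?M (measure_pmf J)" by (rule measurable_component_singleton) simp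
    then show "(\<lambda>\<omega>. f (\<omega> i)) \<in> measurable ?M (measure_pmf (map_pmf f J))"
      by (rule measurable_compose) simp
  qed (simp add: space_PiM)
  have eq: "measure (PiM UNIV (\<lambda>_. measure_pmf (map_pmf f J))) X = measure ?M {\<omega>. (\<lambda>v. f (\<omega> v)) \<in> X}"
    if "X \<in> sets (PiM UNIV (\<lambda>_. measure_pmf (map_pmf f J)))" for f :: "_ \<Rightarrow> bool" and X
  proof -
    have "measure (PiM UNIV (\<lambda>_. measure_pmf (map_pmf f J))) X
        = measure (distr ?M (PiM UNIV (\<lambda>_. measure_pmf (map_pmf f J))) (\<lambda>\<omega> v. f (\<omega> v))) X"
      by (simp only: distr_PiM_map_pmf)
    also have "\<dots> = measure ?M ((\<lambda>\<omega> v. f (\<omega> v)) -` X \<inter> space ?M)"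
      by (rule measure_distr[OF m that])
    finally show ?thesis by (simp add: space_PiM vimage_def)
  qed
  have sb: "lip_above b \<in> sets (PiM UNIV (\<lambda>_ :: 'd site. measure_pmf (bernoulli_pmf r)))" for r
    using lip_above_sets_perc[of b r] unfolding perc_def .
  have "measure (perc p) (lip_above b) = measure ?M {\<omega>. (\<lambda>v. case \<omega> v of (x, y) \<Rightarrow> x \<and> y) \<in> lip_above b}"
    using eq[of "lip_above b" "\<lambda>(x, y). x \<and> y"] sb unfolding snd perc_def by simp
  also have "\<dots> \<le> measure ?M {\<omega>. (\<lambda>v. fst (\<omega> v)) \<in> lip_above b}"
  proof (rule M.finite_measure_mono)
    show "{\<omega>. (\<lambda>v. case \<omega> v of (x, y) \<Rightarrow> x \<and> y) \<in> lip_above b} \<subseteq> {\<omega>. (\<lambda>v. fst (\<omega> v)) \<in> lip_above b}"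
      unfolding lip_above_def by (auto simp: case_prod_beta)
    show "{\<omega>. (\<lambda>v. fst (\<omega> v)) \<in> lip_above b} \<in> M.events"
      using measurable_sets[OF m[of fst], of "lip_above b"] sb unfolding fst by (simp add: space_PiM vimage_def)
  qed
  also have "\<dots> = measure (perc p') (lip_above b)"
    using eq[of "lip_above b" fst] sb unfolding fst perc_def by simp
  finally show ?thesis .
qed

section \<open>Almost sure existence at high density\<close>

lemma finite_steps: "finite (steps :: 'd::finite site set)"
proof -
  have "{z :: int ^ 'd. l1_norm z = 1} \<subseteq> vec_lambda ` (\<Pi>\<^sub>E i\<in>UNIV. {-1..1})"
  proof
    fix z :: "int ^ 'd" assume "z \<in> {z. l1_norm z = 1}"
    then have "(\<Sum>i\<in>UNIV. \<bar>z $ i\<bar>) = 1" by (simp add: l1_norm_def)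
    then have "\<bar>z $ i\<bar> \<le> 1" for i
      using member_le_sum[of i UNIV "\<lambda>i. \<bar>z $ i\<bar>"] by simp
    then have "vec_nth z \<in> (\<Pi>\<^sub>E i\<in>UNIV. {-1..1})" by (auto simp: PiE_iff abs_le_iff minus_le_iff)
    then show "z \<in> vec_lambda ` (\<Pi>\<^sub>E i\<in>UNIV. {-1..1})" by (metis image_eqI vec_nth_inverse)
  qed
  moreover have "finite (vec_lambda ` (\<Pi>\<^sub>E i\<in>(UNIV :: 'd set). {-1..1 :: int}))"
    by (intro finite_imageI finite_PiE) auto
  ultimately have "finite {z :: int ^ 'd. l1_norm z = 1}" by (rule finite_subset)
  then show ?thesis unfolding steps_def by simp
qed

lemma card_steps_nonzero: "card (steps :: 'd::finite site set) \<noteq> 0"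
proof -
  have "(0, 1) \<in> (steps :: 'd site set)" by (simp add: steps_def)
  then show ?thesis using finite_steps card_eq_0_iff by blast
qed

lemma walk_steps: "walk b \<omega> v ws \<Longrightarrow> set ws \<subseteq> steps"
proof (induction ws arbitrary: v)
  case (Cons s ws)
  then show ?case using Cons.IH[of "v - s"] by simp
qed simp

primrec visited :: "'d::finite site \<Rightarrow> 'd site list \<Rightarrow> 'd site list" where
  "visited v [] = [v]"
| "visited v (s # ws) = v # visited (v - s) ws"

text \<open>
  The sites that have to be closed for the walk to be possible.
\<close>

primrec up_sites :: "'d::finite site \<Rightarrow> 'd site list \<Rightarrow> 'd site set" where
  "up_sites v [] = {}"
| "up_sites v (s # ws) = (if s = (0, 1) then insert v (up_sites (v - s) ws) else up_sites (v - s) ws)"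

lemma up_sites_subset_visited: "up_sites v ws \<subseteq> set (visited v ws)"
proof (induction ws arbitrary: v)
  case (Cons s ws)
  have "up_sites (v - s) ws \<subseteq> set (visited (v - s) ws)" by (rule Cons.IH)
  then show ?case by auto
qed simp

lemma finite_up_sites [simp]: "finite (up_sites v ws)"
  by (rule finite_subset[OF up_sites_subset_visited]) simp

lemma walk_up_sites_closed: "walk b \<omega> v ws \<Longrightarrow> u \<in> up_sites v ws \<Longrightarrow> \<not> \<omega> u"
  by (induction ws arbitrary: v) (auto split: if_splits)

text \<open>
  Without repeated sites, distinct steps up use distinct closed sites. This is what turns the
  number of steps up into an exponent of the closing probability.
\<close>

lemma card_up_sites: "distinct (visited v ws) \<Longrightarrow> card (up_sites v ws) = count_list ws (0, 1)"
proof (induction ws arbitrary: v)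
  case (Cons s ws)
  then have "v \<notin> up_sites (v - s) ws" using up_sites_subset_visited[of "v - s" ws] by auto
  with Cons.prems Cons.IH[of "v - s"] show ?case by (cases "s = (0, 1)") auto
qed simp

lemma walk_from_visited:
  "walk b \<omega> v ws \<Longrightarrow> distinct (visited v ws) \<Longrightarrow> u \<in> set (visited v ws) \<Longrightarrow>
     \<exists>ws'. walk b \<omega> u ws' \<and> distinct (visited u ws')"
proof (induction ws arbitrary: v)
  case Nil
  then show ?case by (intro exI[of _ "[]"]) simp
next
  case (Cons s ws)
  show ?case
  proof (cases "u = v")
    case True
    with Cons.prems show ?thesis by (intro exI[of _ "s # ws"]) simp
  next
    case False
    with Cons.prems show ?thesis by (intro Cons.IH[of "v - s"]) auto
  qed
qed

text \<open>
  If the walk has been at its end point before, then its initial part already leads there.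
\<close>

lemma walk_loop_erased:
  "walk b \<omega> v ws \<Longrightarrow> \<exists>ws'. walk b \<omega> v ws' \<and> distinct (visited v ws')"
proof (induction ws arbitrary: v)
  case Nil
  then show ?case by (intro exI[of _ "[]"]) simp
next
  case (Cons s ws)
  then have "walk b \<omega> (v - s) ws" by simp
  from Cons.IH[OF this] obtain ws' where ws': "walk b \<omega> (v - s) ws'" "distinct (visited (v - s) ws')"
    by blast
  show ?case
  proof (cases "v \<in> set (visited (v - s) ws')")
    case True
    then show ?thesis using walk_from_visited ws' by blast
  next
    case False
    then show ?thesis using ws' Cons.prems by (intro exI[of _ "s # ws'"]) auto
  qed
qed

text \<open>
  Height above the plane of slope \<open>\<alpha> \<eta>\<close>, before rounding.
\<close>

definition tilted_height :: "real \<Rightarrow> int ^ 'd::finite \<Rightarrow> 'd site \<Rightarrow> real" where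
  "tilted_height \<alpha> \<eta> v = real_of_int (snd v) - \<alpha> * real_of_int (\<Sum>i\<in>UNIV. \<eta> $ i * fst v $ i)"

lemma tilted_height_diff:
  "tilted_height \<alpha> \<eta> (v - s) = tilted_height \<alpha> \<eta> v - tilted_height \<alpha> \<eta> s"
  unfolding tilted_height_def by (simp add: algebra_simps sum_subtractf)

lemma abs_inner_le_l1_norm:
  assumes "\<And>i. \<eta> $ i \<in> {-1, 0, 1}"
  shows "\<bar>\<Sum>i\<in>UNIV. \<eta> $ i * x $ i\<bar> \<le> l1_norm x"
proof -
  have "\<bar>\<Sum>i\<in>UNIV. \<eta> $ i * x $ i\<bar> \<le> (\<Sum>i\<in>UNIV. \<bar>\<eta> $ i * x $ i\<bar>)" by (rule sum_abs)
  also have "\<dots> \<le> (\<Sum>i\<in>UNIV. \<bar>x $ i\<bar>)"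
  proof (rule sum_mono)
    fix i show "\<bar>\<eta> $ i * x $ i\<bar> \<le> \<bar>x $ i\<bar>" using assms[of i] by auto
  qed
  finally show ?thesis by (simp add: l1_norm_def)
qed

text \<open>
  A step up raises the tilted height by \<open>1\<close>, and a diagonal step lowers it by at least
  \<open>1 - \<alpha>\<close>, because the plane changes by at most \<open>\<alpha>\<close> over a unit step.
\<close>

lemma walk_height_le:
  assumes \<eta>: "\<And>i. \<eta> $ i \<in> {-1, 0, 1}" and \<alpha>: "0 \<le> \<alpha>" "\<alpha> < 1"
  shows "walk (plane \<alpha> \<eta>) \<omega> v ws \<Longrightarrow>
    tilted_height \<alpha> \<eta> v \<le> real (count_list ws (0, 1))
      - (1 - \<alpha>) * (real (length ws) - real (count_list ws (0, 1)))"
proof (induction ws arbitrary: v)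
  case Nil
  then show ?case by (simp add: tilted_height_def plane_def le_floor_iff)
next
  case (Cons s ws)
  have IH: "tilted_height \<alpha> \<eta> v - tilted_height \<alpha> \<eta> s \<le> real (count_list ws (0, 1))
      - (1 - \<alpha>) * (real (length ws) - real (count_list ws (0, 1)))"
    using Cons.IH[of "v - s"] Cons.prems by (simp add: tilted_height_diff)
  show ?case
  proof (cases "s = (0, 1)")
    case True
    with IH show ?thesis by (simp add: tilted_height_def)
  next
    case False
    then obtain z where z: "s = (z, -1)" "l1_norm z = 1"
      using Cons.prems by (auto simp: steps_def)
    have "\<bar>real_of_int (\<Sum>i\<in>UNIV. \<eta> $ i * z $ i)\<bar> \<le> 1"
      using abs_inner_le_l1_norm[OF \<eta>, of z] z(2) by (metis of_int_abs of_int_le_1_iff)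
    then have "\<alpha> * (- real_of_int (\<Sum>i\<in>UNIV. \<eta> $ i * z $ i)) \<le> \<alpha> * 1"
      using \<alpha> by (intro mult_left_mono) auto
    then have "tilted_height \<alpha> \<eta> s \<le> - (1 - \<alpha>)" using z by (simp add: tilted_height_def)
    with IH False show ?thesis by (simp add: algebra_simps)
  qed
qed

text \<open>
  Diagonal steps have to be paid for by steps up, so a walk that ends above the plane has a
  positive fraction of steps up.
\<close>

lemma walk_length_le:
  assumes \<eta>: "\<And>i. \<eta> $ i \<in> {-1, 0, 1}" and \<alpha>: "0 \<le> \<alpha>" "\<alpha> < 1"
    and K: "1 + 1 / (1 - \<alpha>) \<le> real K"
    and w: "walk (plane \<alpha> \<eta>) \<omega> v ws" and v: "real j \<le> tilted_height \<alpha> \<eta> v"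
  shows "j \<le> length ws" "length ws \<le> K * count_list ws (0, 1)"
proof -
  let ?U = "real (count_list ws (0, 1))" and ?L = "real (length ws)"
  have h: "real j \<le> ?U - (1 - \<alpha>) * (?L - ?U)" using walk_height_le[OF \<eta> \<alpha> w] v by simp
  have UL: "?U \<le> ?L" by (simp add: count_le_length)
  then have "0 \<le> (1 - \<alpha>) * (?L - ?U)" using \<alpha> by simp
  with h UL show "j \<le> length ws" by simp
  have "(1 - \<alpha>) * (?L - ?U) \<le> ?U" using h by simp
  then have "?L - ?U \<le> ?U / (1 - \<alpha>)" using \<alpha> by (simp add: pos_le_divide_eq mult.commute)
  then have "?L \<le> (1 + 1 / (1 - \<alpha>)) * ?U" by (simp add: algebra_simps)
  also have "\<dots> \<le> real K * ?U" using K by (intro mult_right_mono) auto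
  finally show "length ws \<le> K * count_list ws (0, 1)" by (metis of_nat_le_iff of_nat_mult)
qed

definition closed_at :: "'d::finite site set \<Rightarrow> 'd config set" where
  "closed_at A = {\<omega>. \<forall>v\<in>A. \<not> \<omega> v}"

lemma closed_at_sets [measurable]: "finite A \<Longrightarrow> closed_at A \<in> sets (perc p)"
proof -
  assume "finite A"
  then have "{\<omega> \<in> space (perc p). \<forall>v\<in>A. \<not> \<omega> v} \<in> sets (perc p)" by measurable
  then show ?thesis by (simp add: closed_at_def)
qed

lemma reach_sets [measurable]: "{\<omega>. reach b \<omega> v} \<in> sets (perc p)"
proof -
  have "Measurable.pred (perc p) (\<lambda>\<omega>. walk b \<omega> v ws)" for ws
    by (induction ws arbitrary: v) simp_all
  then have "{\<omega> \<in> space (perc p). \<exists>ws. walk b \<omega> v ws} \<in> sets (perc p)" by measurable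
  then show ?thesis by (simp add: reach_def)
qed

text \<open>
  Union bound over the walks of length \<open>n \<ge> j\<close>: there are at most \<open>(card steps)^n\<close> of them. Each
  needs at least \<open>n / K\<close> distinct closed sites, so with closing probability \<open>r ^ K\<close> it is
  possible with probability at most \<open>r ^ n\<close>. The choice of \<open>r\<close> makes the product
  \<open>(1 / 2) ^ n\<close>.
\<close>

lemma reach_prob_le:
  fixes \<eta> :: "int ^ 'd::finite"
  assumes \<eta>: "\<And>i. \<eta> $ i \<in> {-1, 0, 1}" and \<alpha>: "0 \<le> \<alpha>" "\<alpha> < 1"
    and K: "1 + 1 / (1 - \<alpha>) \<le> real K"
    and r: "r = 1 / (2 * real (card (steps :: 'd site set)))"
    and v: "real j \<le> tilted_height \<alpha> \<eta> v"
  shows "measure (perc (1 - r ^ K)) {\<omega>. reach (plane \<alpha> \<eta>) \<omega> v} \<le> 2 * (1 / 2) ^ j"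
proof -
  let ?M = "perc (1 - r ^ K) :: 'd config measure"
  interpret prob_space ?M by (rule prob_space_perc)
  have "card (steps :: 'd site set) \<noteq> 0" by (rule card_steps_nonzero)
  then have c: "1 \<le> real (card (steps :: 'd site set))" by simp
  then have r01: "0 < r" "r \<le> 1" unfolding r by auto
  then have q01: "0 \<le> r ^ K" "r ^ K \<le> 1" by (auto intro: power_le_one)
  define W where "W n = {ws :: 'd site list. set ws \<subseteq> steps \<and> length ws = n \<and> distinct (visited v ws)
      \<and> n \<le> K * count_list ws (0, 1)}" for n
  have W_sub: "W n \<subseteq> {ws. set ws \<subseteq> steps \<and> length ws = n}" for n unfolding W_def by auto
  have W_fin: "finite (W n)" for n
    by (rule finite_subset[OF W_sub finite_lists_length_eq[OF finite_steps]])
  have W_card: "real (card (W n)) \<le> real (card (steps :: 'd site set)) ^ n" for n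
    using card_mono[OF finite_lists_length_eq[OF finite_steps] W_sub, of n] 
    by (simp add: card_lists_length_eq[OF finite_steps] flip: of_nat_power)
  have single: "prob (closed_at (up_sites v ws)) \<le> r ^ n" if "ws \<in> W n" for ws n
  proof -
    have "prob (closed_at (up_sites v ws)) = (r ^ K) ^ count_list ws (0, 1)"
      using perc_cylinder[of "{}" "up_sites v ws" "1 - r ^ K"] q01 that card_up_sites[of v ws]
      unfolding W_def closed_at_def by simp
    also have "\<dots> = r ^ (K * count_list ws (0, 1))" by (simp add: power_mult)
    also have "\<dots> \<le> r ^ n" using that r01 unfolding W_def by (intro power_decreasing) auto
    finally show ?thesis .
  qed
  define A where "A n = (\<Union>ws\<in>W (n + j). closed_at (up_sites v ws))" for n
  have A_sets: "A n \<in> events" for n unfolding A_def using W_fin by auto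
  have A_prob: "prob (A n) \<le> (1 / 2) ^ (n + j)" for n
  proof -
    have "prob (A n) \<le> (\<Sum>ws\<in>W (n + j). prob (closed_at (up_sites v ws)))"
      unfolding A_def using W_fin by (intro measure_UNION_le) auto
    also have "\<dots> \<le> (\<Sum>ws\<in>W (n + j). r ^ (n + j))" by (intro sum_mono single)
    also have "\<dots> \<le> real (card (steps :: 'd site set)) ^ (n + j) * r ^ (n + j)"
      using W_card[of "n + j"] r01 by (auto intro: mult_right_mono)
    also have "\<dots> = (1 / 2) ^ (n + j)"
      unfolding power_mult_distrib[symmetric] using c by (simp add: r)
    finally show ?thesis .
  qed
  have geo: "(\<lambda>n. (1 / 2 :: real) ^ (n + j)) sums (2 * (1 / 2) ^ j)"
    using sums_mult2[OF geometric_sums[of "1 / 2 :: real"], of "(1 / 2) ^ j"] by (simp add: power_add)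
  have sm: "summable (\<lambda>n. prob (A n))"
    by (rule summable_comparison_test'[of _ 0, OF sums_summable[OF geo]]) (simp add: A_prob)
  have "{\<omega>. reach (plane \<alpha> \<eta>) \<omega> v} \<subseteq> (\<Union>n. A n)"
  proof
    fix \<omega> assume "\<omega> \<in> {\<omega>. reach (plane \<alpha> \<eta>) \<omega> v}"
    then obtain ws where ws: "walk (plane \<alpha> \<eta>) \<omega> v ws" "distinct (visited v ws)"
      using walk_loop_erased unfolding reach_def by blast
    have "ws \<in> W (length ws - j + j)"
      using walk_length_le[OF \<eta> \<alpha> K ws(1) v] walk_steps[OF ws(1)] ws(2) unfolding W_def by simp
    moreover have "\<omega> \<in> closed_at (up_sites v ws)"
      using walk_up_sites_closed[OF ws(1)] unfolding closed_at_def by blast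
    ultimately show "\<omega> \<in> (\<Union>n. A n)" unfolding A_def by blast
  qed
  then have "prob {\<omega>. reach (plane \<alpha> \<eta>) \<omega> v} \<le> prob (\<Union>n. A n)"
    using A_sets by (intro finite_measure_mono) auto
  also have "\<dots> \<le> (\<Sum>n. prob (A n))"
    using A_sets sm by (intro finite_measure_subadditive_countably) auto
  also have "\<dots> \<le> (\<Sum>n. (1 / 2) ^ (n + j))"
    by (rule suminf_le[OF A_prob sm sums_summable[OF geo]])
  also have "\<dots> = 2 * (1 / 2) ^ j" using geo by (rule sums_unique[symmetric])
  finally show ?thesis .
qed

text \<open>
  The bounds on the probabilities of reaching the sites over a base point are summable in the
  height, so by the Borel-Cantelli lemma the reachable heights over each base point are almost
  surely bounded.
\<close>

theorem supercritical_exists: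
  fixes \<eta> :: "int ^ 'd::finite"
  assumes \<eta>: "\<And>i. \<eta> $ i \<in> {-1, 0, 1}" and \<alpha>: "0 \<le> \<alpha>" "\<alpha> < 1"
  shows "\<exists>p. 0 \<le> p \<and> p < 1 \<and> measure (perc p) (lip_above (plane \<alpha> \<eta>)) = 1"
proof -
  obtain K :: nat where K: "1 + 1 / (1 - \<alpha>) \<le> real K" using real_arch_simple by blast
  define r where "r = 1 / (2 * real (card (steps :: 'd site set)))"
  let ?M = "perc (1 - r ^ K) :: 'd config measure"
  interpret prob_space ?M by (rule prob_space_perc)
  have "card (steps :: 'd site set) \<noteq> 0" by (rule card_steps_nonzero)
  then have r01: "0 < r" "r \<le> 1" unfolding r_def by auto
  have ae: "AE \<omega> in ?M. \<exists>H. \<forall>h\<ge>H. \<not> reach (plane \<alpha> \<eta>) \<omega> (x, h)" for x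
  proof -
    define C where "C = \<lceil>\<alpha> * real_of_int (\<Sum>i\<in>UNIV. \<eta> $ i * x $ i)\<rceil>"
    let ?E = "\<lambda>j. {\<omega>. reach (plane \<alpha> \<eta>) \<omega> (x, C + int j)}"
    have "real j \<le> tilted_height \<alpha> \<eta> (x, C + int j)" for j
      unfolding tilted_height_def C_def by (simp add: le_of_int_ceiling)
    then have le: "prob (?E j) \<le> 2 * (1 / 2) ^ j" for j
      by (rule reach_prob_le[OF \<eta> \<alpha> K r_def])
    have "summable (\<lambda>j. 2 * (1 / 2 :: real) ^ j)" by (intro summable_mult summable_geometric) simp
    then have "summable (\<lambda>j. prob (?E j))"
      by (rule summable_comparison_test'[of _ 0]) (use le in simp)
    then have "AE \<omega> in ?M. eventually (\<lambda>j. \<omega> \<in> space ?M - ?E j) sequentially"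
      by (intro borel_cantelli_AE1) (auto simp: emeasure_eq_measure)
    then show ?thesis
    proof eventually_elim
      case (elim \<omega>)
      then obtain N where N: "\<And>j. j \<ge> N \<Longrightarrow> \<not> reach (plane \<alpha> \<eta>) \<omega> (x, C + int j)"
        unfolding eventually_sequentially by auto
      have "\<not> reach (plane \<alpha> \<eta>) \<omega> (x, h)" if "h \<ge> C + int N" for h
        using N[of "nat (h - C)"] that by simp
      then show ?case by blast
    qed
  qed
  then have "AE \<omega> in ?M. \<forall>x. \<exists>H. \<forall>h\<ge>H. \<not> reach (plane \<alpha> \<eta>) \<omega> (x, h)"
    by (simp add: AE_all_countable)
  then have "AE \<omega> in ?M. \<omega> \<in> lip_above (plane \<alpha> \<eta>)" by (simp add: lip_above_iff)
  then have "prob (lip_above (plane \<alpha> \<eta>)) = 1" by (simp add: prob_eq_1)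
  moreover have "0 \<le> 1 - r ^ K" "1 - r ^ K < 1" using r01 by (auto intro: power_le_one)
  ultimately show ?thesis by blast
qed

section \<open>Ranking the points of a simplex\<close>

lemma fact_mult_power_le: "fact n * (n + 1) ^ d \<le> (fact (n + d) :: nat)"
proof (induction d)
  case (Suc d)
  have "fact n * (n + 1) ^ Suc d = (n + 1) * (fact n * (n + 1) ^ d)" by (simp add: algebra_simps)
  also have "\<dots> \<le> (n + Suc d) * fact (n + d)" using Suc by (intro mult_mono) auto
  finally show ?case by simp
qed simp

lemma finite_simplex: "finite {m :: 'd::finite \<Rightarrow> nat. sum m UNIV < N}"
proof (rule finite_subset)
  show "{m :: 'd \<Rightarrow> nat. sum m UNIV < N} \<subseteq> (\<Pi>\<^sub>E i\<in>UNIV. {..<N})"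
  proof
    fix m :: "'d \<Rightarrow> nat" assume "m \<in> {m. sum m UNIV < N}"
    moreover have "m i \<le> sum m UNIV" for i by (rule member_le_sum) auto
    ultimately have "m i < N" for i using le_less_trans by blast
    then show "m \<in> (\<Pi>\<^sub>E i\<in>UNIV. {..<N})" by auto
  qed
  show "finite (\<Pi>\<^sub>E i\<in>(UNIV :: 'd set). {..<N})" by (intro finite_PiE) auto
qed

text \<open>
  Adding a slack coordinate turns the vectors of sum less than \<open>n + 1\<close> into the vectors of
  \<open>d + 1\<close> coordinates with sum exactly \<open>n\<close>, which are counted by \<open>(n + d) choose n\<close>.
\<close>

lemma simplex_card_ge:
  "N ^ CARD('d) \<le> fact CARD('d) * card {m :: 'd::finite \<Rightarrow> nat. sum m UNIV < N}"
proof (cases N)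
  case 0
  then show ?thesis by (simp add: card_gt_0_iff)
next
  case (Suc n)
  let ?d = "CARD('d)"
  obtain g :: "'d \<Rightarrow> nat" where g: "bij_betw g UNIV {0..<?d}"
    using ex_bij_betw_finite_nat[of "UNIV :: 'd set"] by auto
  let ?L = "{l :: nat list. length l = ?d + 1 \<and> sum_list l = n}"
  let ?\<phi> = "\<lambda>l i. l ! g i"
  have sum_\<phi>: "sum (?\<phi> l) UNIV + l ! ?d = n" if "l \<in> ?L" for l
  proof -
    have "sum (?\<phi> l) UNIV = (\<Sum>j\<in>{0..<?d}. l ! j)"
      by (rule sum.reindex_bij_betw[OF g])
    moreover have "sum_list l = (\<Sum>j\<in>{0..<Suc ?d}. l ! j)" using that by (simp add: sum_list_sum_nth)
    ultimately show ?thesis using that by simp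
  qed
  have "inj_on ?\<phi> ?L"
  proof (rule inj_onI)
    fix l l' assume l: "l \<in> ?L" "l' \<in> ?L" and eq: "?\<phi> l = ?\<phi> l'"
    have "sum (?\<phi> l) UNIV = sum (?\<phi> l') UNIV" unfolding eq ..
    then have last: "l ! ?d = l' ! ?d" using sum_\<phi>[OF l(1)] sum_\<phi>[OF l(2)] by linarith
    have "l ! j = l' ! j" if "j < length l" for j
    proof (cases "j = ?d")
      case False
      then have "j \<in> g ` UNIV" using that l g by (auto simp: bij_betw_def)
      then show ?thesis using eq by (auto dest: fun_cong)
    qed (simp add: last)
    then show "l = l'" using l by (intro nth_equalityI) auto
  qed
  moreover have "?\<phi> ` ?L \<subseteq> {m. sum m UNIV < N}"
  proof
    fix m assume "m \<in> ?\<phi> ` ?L"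
    then obtain l where "l \<in> ?L" "m = ?\<phi> l" by blast
    then show "m \<in> {m. sum m UNIV < N}" using sum_\<phi>[of l] Suc by simp
  qed
  ultimately have "card ?L \<le> card {m :: 'd \<Rightarrow> nat. sum m UNIV < N}"
    using finite_simplex by (rule card_inj_on_le)
  then have c: "(n + ?d) choose n \<le> card {m :: 'd \<Rightarrow> nat. sum m UNIV < N}"
    by (simp only: card_length_sum_list) simp
  have "fact n * (n + 1) ^ ?d \<le> (fact (n + ?d) :: nat)" by (rule fact_mult_power_le)
  also have "\<dots> = fact n * (fact ?d * ((n + ?d) choose n))"
    using binomial_fact_lemma[of n "n + ?d"] by (simp add: mult.assoc)
  finally have "(n + 1) ^ ?d \<le> fact ?d * ((n + ?d) choose n)" by simp
  also have "\<dots> \<le> fact ?d * card {m :: 'd \<Rightarrow> nat. sum m UNIV < N}"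
    using c by (rule mult_left_mono) simp
  finally show ?thesis using Suc by simp
qed

text \<open>
  The vectors of natural numbers are listed in order of their coordinate sum by always choosing a
  vector of least sum among those not yet listed. The prefix collects the first \<open>r\<close> of them.
\<close>

primrec simplex_prefix :: "nat \<Rightarrow> ('d::finite \<Rightarrow> nat) set" where
  "simplex_prefix 0 = {}"
| "simplex_prefix (Suc r) =
     insert (arg_min (\<lambda>m. sum m UNIV) (\<lambda>m. m \<notin> simplex_prefix r)) (simplex_prefix r)"

definition simplex_enum :: "nat \<Rightarrow> ('d::finite \<Rightarrow> nat)" where
  "simplex_enum r = arg_min (\<lambda>m. sum m UNIV) (\<lambda>m. m \<notin> simplex_prefix r)"

lemma finite_simplex_prefix: "finite (simplex_prefix r)"
  by (induction r) auto

lemma simplex_enum_least: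
  "simplex_enum r \<notin> (simplex_prefix r :: ('d::finite \<Rightarrow> nat) set)"
  "(m :: 'd \<Rightarrow> nat) \<notin> simplex_prefix r \<Longrightarrow> sum (simplex_enum r :: 'd \<Rightarrow> nat) UNIV \<le> sum m UNIV"
proof -
  have "infinite (UNIV :: ('d \<Rightarrow> nat) set)" by (simp add: finite_UNIV_fun)
  then obtain m :: "'d \<Rightarrow> nat" where "m \<notin> simplex_prefix r"
    using ex_new_if_finite finite_simplex_prefix by blast
  from arg_min_nat_lemma[of "\<lambda>m. m \<notin> simplex_prefix r", OF this, of "\<lambda>m. sum m UNIV"]
  show "simplex_enum r \<notin> (simplex_prefix r :: ('d::finite \<Rightarrow> nat) set)"
    "(m :: 'd \<Rightarrow> nat) \<notin> simplex_prefix r \<Longrightarrow> sum (simplex_enum r :: 'd \<Rightarrow> nat) UNIV \<le> sum m UNIV" for m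
    unfolding simplex_enum_def by auto
qed

lemma simplex_prefix_Suc: "simplex_prefix (Suc r) = insert (simplex_enum r) (simplex_prefix r)"
  by (simp add: simplex_enum_def)

lemma card_simplex_prefix: "card (simplex_prefix r :: ('d::finite \<Rightarrow> nat) set) = r"
proof (induction r)
  case (Suc r)
  have "(simplex_enum r :: 'd \<Rightarrow> nat) \<notin> simplex_prefix r" by (rule simplex_enum_least)
  with Suc show ?case
    unfolding simplex_prefix_Suc by (simp add: finite_simplex_prefix)
qed simp

lemma simplex_enum_in_prefix: "r < r' \<Longrightarrow> simplex_enum r \<in> simplex_prefix r'"
proof (induction r')
  case (Suc r')
  then show ?case unfolding simplex_prefix_Suc by (cases "r = r'") auto
qed simp

lemma inj_simplex_enum: "inj simplex_enum"
  by (rule linorder_injI) (metis simplex_enum_in_prefix simplex_enum_least(1))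

text \<open>
  All vectors of smaller coordinate sum are among the \<open>r\<close> earlier ones, and
  \<open>simplex_card_ge\<close> bounds their number from below.
\<close>

lemma simplex_enum_size:
  "sum (simplex_enum r :: 'd::finite \<Rightarrow> nat) UNIV ^ CARD('d) \<le> fact CARD('d) * r"
proof -
  let ?N = "sum (simplex_enum r :: 'd \<Rightarrow> nat) UNIV"
  have "{m :: 'd \<Rightarrow> nat. sum m UNIV < ?N} \<subseteq> simplex_prefix r"
    using simplex_enum_least(2)[of _ r] by (auto simp flip: not_le)
  then have "card {m :: 'd \<Rightarrow> nat. sum m UNIV < ?N} \<le> r"
    using card_mono[OF finite_simplex_prefix[of r]] card_simplex_prefix[of r] by metis
  then have "fact CARD('d) * card {m :: 'd \<Rightarrow> nat. sum m UNIV < ?N} \<le> fact CARD('d) * r" by simp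
  then show ?thesis using simplex_card_ge[of ?N, where 'd = 'd] by linarith
qed

text \<open>
  Convexity of \<open>x ^ d\<close>: the graph lies above its tangent at \<open>t\<close>. Solved for \<open>x\<close>, it bounds
  \<open>\<bar>e\<bar>\<close> by a linear function of \<open>\<bar>e\<bar> ^ d\<close>, so that only a linear bound in the rank remains.
\<close>

lemma power_ge_tangent:
  fixes x t :: real
  assumes "0 \<le> x" "0 < t" "0 < d"
  shows "x \<le> t + (x ^ d - t ^ d) / (real d * t ^ (d - 1))"
proof -
  have "1 + real d * (x / t - 1) \<le> (1 + (x / t - 1)) ^ d"
    using assms by (intro Bernoulli_inequality) simp
  then have "t ^ d * (1 + real d * (x / t - 1)) \<le> t ^ d * (x / t) ^ d"
    using assms by (intro mult_left_mono) auto
  also have "\<dots> = x ^ d" using assms by (simp add: power_divide)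
  finally have "t ^ d + t ^ d * (real d * (x / t - 1)) \<le> x ^ d" by (simp add: distrib_left)
  moreover have "t ^ d = t * t ^ (d - 1)" using assms(3) by (simp add: power_eq_if)
  then have "t ^ d * (real d * (x / t - 1)) = real d * t ^ (d - 1) * (x - t)"
    using assms by (simp only:) (simp add: field_simps)
  ultimately have "t ^ d + real d * t ^ (d - 1) * (x - t) \<le> x ^ d" by simp
  then have "(x - t) * (real d * t ^ (d - 1)) \<le> x ^ d - t ^ d" by (simp add: algebra_simps)
  then have "x - t \<le> (x ^ d - t ^ d) / (real d * t ^ (d - 1))"
    using assms by (subst pos_le_divide_eq) auto
  then show ?thesis by simp
qed

section \<open>Number of open probes\<close>

text \<open>
  The right-hand side is the probability that \<open>sum_list rs\<close> prescribed sites are open and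
  \<open>length rs\<close> prescribed sites are closed, for closing probability \<open>q\<close>.
\<close>

lemma replicate_geometric_pmf:
  assumes "0 < q" "q \<le> 1"
  shows "pmf (replicate_pmf (length rs) (geometric_pmf q)) rs = (1 - q) ^ sum_list rs * q ^ length rs"
proof (induction rs)
  case (Cons r rs)
  have "replicate_pmf (length (r # rs)) (geometric_pmf q)
      = map_pmf (\<lambda>(x, xs). x # xs) (pair_pmf (geometric_pmf q) (replicate_pmf (length rs) (geometric_pmf q)))"
    by (simp add: pair_pmf_def map_bind_pmf bind_map_pmf map_pmf_def bind_assoc_pmf bind_return_pmf)
  moreover have "inj (\<lambda>(x, xs). x # xs)" by (auto simp: inj_def)
  ultimately have "pmf (replicate_pmf (length (r # rs)) (geometric_pmf q)) (r # rs)
      = pmf (pair_pmf (geometric_pmf q) (replicate_pmf (length rs) (geometric_pmf q))) (r, rs)"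
    using pmf_map_inj'[of "\<lambda>(x, xs). x # xs" _ "(r, rs)"] by simp
  then show ?case using Cons assms by (simp add: pmf_pair power_add)
qed simp

lemma replicate_geometric_mean:
  assumes "0 < q" "q \<le> 1"
  shows "(\<integral>\<^sup>+rs. of_nat (sum_list rs) \<partial>replicate_pmf k (geometric_pmf q)) = of_nat k * ennreal ((1 - q) / q)"
proof (induction k)
  case (Suc k)
  have "(\<integral>\<^sup>+r. of_nat r \<partial>geometric_pmf q) = ennreal ((1 - q) / q)"
    using expectation_geometric_pmf[of q] integrable_real_geometric_pmf[of q] assms
      nn_integral_eq_integral[of "measure_pmf (geometric_pmf q)" real]
    by (simp add: ennreal_of_nat_eq_real_of_nat)
  then show ?case using Suc
    by (simp add: nn_integral_add algebra_simps)
qed simp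

lemma replicate_geometric_markov:
  assumes q: "0 < q" "q \<le> 1" and s: "0 < s" and k: "0 < k"
  shows "measure (replicate_pmf k (geometric_pmf q)) {rs. length rs = k \<and> real (sum_list rs) \<le> real k * s}
    \<ge> 1 - (1 - q) / q / s"
proof -
  let ?Q = "replicate_pmf k (geometric_pmf q)"
  have "emeasure ?Q {rs \<in> UNIV. 1 \<le> ennreal (1 / (real k * s)) * of_nat (sum_list rs)} \<le>
      ennreal (1 / (real k * s)) * (\<integral>\<^sup>+rs. of_nat (sum_list rs) * indicator UNIV rs \<partial>?Q)"
    using nn_integral_Markov_inequality[of "\<lambda>rs. of_nat (sum_list rs)" UNIV "measure_pmf ?Q"
        "ennreal (1 / (real k * s))"] by simp
  also have "\<dots> = ennreal (1 / (real k * s)) * (of_nat k * ennreal ((1 - q) / q))"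
    using replicate_geometric_mean[OF q] by simp
  also have "\<dots> = ennreal ((1 - q) / q / s)"
    using q s k by (simp add: ennreal_of_nat_eq_real_of_nat ennreal_mult[symmetric] field_simps)
  finally have "measure ?Q {rs \<in> UNIV. 1 \<le> ennreal (1 / (real k * s)) * of_nat (sum_list rs)} \<le> (1 - q) / q / s"
    using q s by (simp add: measure_pmf.emeasure_eq_measure)
  moreover have "measure ?Q {rs. real k * s < real (sum_list rs)} \<le>
      measure ?Q {rs \<in> UNIV. 1 \<le> ennreal (1 / (real k * s)) * of_nat (sum_list rs)}"
  proof (rule measure_pmf.finite_measure_mono)
    show "{rs. real k * s < real (sum_list rs)} \<subseteq> {rs \<in> UNIV. 1 \<le> ennreal (1 / (real k * s)) * of_nat (sum_list rs)}"
      using s k by (auto simp: ennreal_of_nat_eq_real_of_nat ennreal_mult[symmetric] ennreal_1[symmetric]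
          field_simps simp del: ennreal_1)
  qed simp
  ultimately have "measure ?Q {rs. real k * s < real (sum_list rs)} \<le> (1 - q) / q / s" by simp
  moreover have "measure ?Q {rs. length rs = k \<and> real (sum_list rs) \<le> real k * s}
      = measure ?Q (UNIV - {rs. real k * s < real (sum_list rs)})"
  proof (rule measure_pmf.finite_measure_eq_AE)
    show "AE rs in ?Q. (rs \<in> {rs. length rs = k \<and> real (sum_list rs) \<le> real k * s})
       = (rs \<in> UNIV - {rs. real k * s < real (sum_list rs)})"
      by (auto simp: AE_measure_pmf_iff set_replicate_pmf not_less)
  qed simp_all
  moreover have "measure ?Q (UNIV - {rs. real k * s < real (sum_list rs)})
      = 1 - measure ?Q {rs. real k * s < real (sum_list rs)}"
    using measure_pmf.prob_compl[where A = "{rs. real k * s < real (sum_list rs)}" and M = ?Q] by simp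
  ultimately show ?thesis by simp
qed

section \<open>The greedy walk\<close>

text \<open>
  The Lipschitz condition between neighbours extends to all distances along a path of unit steps
  that each bring one coordinate closer.
\<close>

lemma lipschitz_l1_norm:
  assumes F: "lipschitz_fun F"
  shows "\<bar>F x - F y\<bar> \<le> l1_norm (x - y)"
proof (induction "nat (l1_norm (x - y))" arbitrary: x)
  case 0
  have "0 \<le> l1_norm (x - y)" by (simp add: l1_norm_def sum_nonneg)
  with 0 have "l1_norm (x - y) = 0" by simp
  then have "\<forall>i. (x - y) $ i = 0" by (simp add: l1_norm_def sum_nonneg_eq_0_iff)
  then have "x = y" by (simp add: vec_eq_iff)
  then show ?case by (simp add: l1_norm_def)
next
  case (Suc n)
  obtain i where i: "(x - y) $ i \<noteq> 0"
  proof (rule ccontr)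
    assume "\<not> thesis"
    then have "\<And>i. (x - y) $ i = 0" using that by blast
    then have "l1_norm (x - y) = 0" by (simp add: l1_norm_def)
    with Suc show False by simp
  qed
  define x' where "x' = x - axis i (sgn ((x - y) $ i))"
  have "l1_norm (x - x') = (\<Sum>j\<in>UNIV. if j = i then 1 else 0)"
    unfolding l1_norm_def x'_def using i by (intro sum.cong) (auto simp: axis_def abs_sgn_eq)
  then have 1: "l1_norm (x - x') = 1" by simp
  have "l1_norm (x' - y) = (\<Sum>j\<in>UNIV. \<bar>(x - y) $ j\<bar> - (if j = i then 1 else 0))"
    unfolding l1_norm_def x'_def using i by (intro sum.cong) (auto simp: axis_def sgn_if)
  then have 2: "l1_norm (x' - y) = l1_norm (x - y) - 1" by (simp add: sum_subtractf l1_norm_def)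
  with Suc have "\<bar>F x' - F y\<bar> \<le> l1_norm (x' - y)" by (intro Suc(1)) simp
  moreover have "\<bar>F x - F x'\<bar> \<le> 1" using F 1 unfolding lipschitz_fun_def by blast
  ultimately show ?case using 2 by simp
qed

text \<open>
  The sign pattern \<open>\<eta>\<close> points the displacement up the plane; the greedy walk moves against it.
\<close>

definition tilt :: "int ^ 'd::finite \<Rightarrow> ('d \<Rightarrow> nat) \<Rightarrow> int ^ 'd" where
  "tilt \<eta> m = (\<chi> i. \<eta> $ i * int (m i))"

text \<open>
  The \<open>r\<close>-th site examined from \<open>v\<close>. It lies one above a site that is reached from \<open>v\<close> by
  diagonal steps, and a closed probe allows the step up.
\<close>

definition probe :: "int ^ 'd::finite \<Rightarrow> 'd site \<Rightarrow> nat \<Rightarrow> 'd site" where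
  "probe \<eta> v r = (fst v - tilt \<eta> (simplex_enum r),
     snd v + 1 - int (sum (simplex_enum r :: 'd \<Rightarrow> nat) UNIV))"

primrec greedy_end :: "int ^ 'd::finite \<Rightarrow> 'd site \<Rightarrow> nat list \<Rightarrow> 'd site" where
  "greedy_end \<eta> v [] = v"
| "greedy_end \<eta> v (r # rs) = greedy_end \<eta> (probe \<eta> v r) rs"

primrec open_probes :: "int ^ 'd::finite \<Rightarrow> 'd site \<Rightarrow> nat list \<Rightarrow> 'd site set" where
  "open_probes \<eta> v [] = {}"
| "open_probes \<eta> v (r # rs) = probe \<eta> v ` {..<r} \<union> open_probes \<eta> (probe \<eta> v r) rs"

primrec closed_probes :: "int ^ 'd::finite \<Rightarrow> 'd site \<Rightarrow> nat list \<Rightarrow> 'd site set" where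
  "closed_probes \<eta> v [] = {}"
| "closed_probes \<eta> v (r # rs) = insert (probe \<eta> v r) (closed_probes \<eta> (probe \<eta> v r) rs)"

text \<open>
  The greedy walk from \<open>v\<close> finds its successive closed sites exactly at the ranks \<open>rs\<close>.
\<close>

definition greedy_event :: "int ^ 'd::finite \<Rightarrow> 'd site \<Rightarrow> nat list \<Rightarrow> 'd config set" where
  "greedy_event \<eta> v rs = {\<omega>. (\<forall>u\<in>open_probes \<eta> v rs. \<omega> u) \<and> (\<forall>u\<in>closed_probes \<eta> v rs. \<not> \<omega> u)}"

text \<open>
  Moving along a diagonal step against \<open>\<eta>\<close> keeps the layer, so all probes of one round share a
  layer, and each round uses the next layer. Hence no site is examined twice.
\<close>

definition layer :: "int ^ 'd::finite \<Rightarrow> 'd site \<Rightarrow> int" where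
  "layer \<eta> v = snd v - (\<Sum>i\<in>UNIV. \<eta> $ i * fst v $ i)"

primrec displacement :: "nat list \<Rightarrow> 'd::finite \<Rightarrow> nat" where
  "displacement [] i = 0"
| "displacement (r # rs) i = simplex_enum r i + displacement rs i"

lemma finite_probes [simp]: "finite (open_probes \<eta> v rs)" "finite (closed_probes \<eta> v rs)"
  by (induction rs arbitrary: v) auto

lemma greedy_event_sets [measurable]: "greedy_event \<eta> v rs \<in> sets (perc p)"
proof -
  have "{\<omega> \<in> space (perc p). (\<forall>u\<in>open_probes \<eta> v rs. \<omega> u) \<and> (\<forall>u\<in>closed_probes \<eta> v rs. \<not> \<omega> u)} \<in> sets (perc p)"
    by measurable
  then show ?thesis by (simp add: greedy_event_def)
qed

lemma greedy_event_Cons: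
  "\<omega> \<in> greedy_event \<eta> v (r # rs) \<longleftrightarrow>
     (\<forall>i<r. \<omega> (probe \<eta> v i)) \<and> \<not> \<omega> (probe \<eta> v r) \<and> \<omega> \<in> greedy_event \<eta> (probe \<eta> v r) rs"
  by (auto simp: greedy_event_def)

lemma greedy_events_disjoint:
  "length rs = length rs' \<Longrightarrow> \<omega> \<in> greedy_event \<eta> v rs \<Longrightarrow> \<omega> \<in> greedy_event \<eta> v rs' \<Longrightarrow> rs = rs'"
proof (induction rs rs' arbitrary: v rule: list_induct2)
  case (Cons r rs r' rs')
  then have "r = r'" unfolding greedy_event_Cons by (meson nat_neq_iff)
  with Cons show ?case unfolding greedy_event_Cons by blast
qed simp

lemma greedy_end_eq:
  fixes \<eta> :: "int ^ 'd::finite"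
  shows "greedy_end \<eta> v rs = (fst v - tilt \<eta> (displacement rs), 
     snd v + int (length rs) - int (sum (displacement rs :: 'd \<Rightarrow> nat) UNIV))"
proof (induction rs arbitrary: v)
  case Nil
  show ?case by (simp add: tilt_def vec_eq_iff prod_eq_iff)
next
  case (Cons r rs)
  have "tilt \<eta> (\<lambda>i. simplex_enum r i + displacement rs i) = tilt \<eta> (simplex_enum r) + tilt \<eta> (displacement rs)"
    by (simp add: tilt_def vec_eq_iff algebra_simps)
  then show ?case using Cons[of "probe \<eta> v r"] by (simp add: probe_def sum.distrib)
qed

text \<open>
  Sum over the rounds of the tangent bound \<open>\<bar>e\<bar> \<le> t + (d! r - t^d) / (d t^(d - 1))\<close>. It is
  linear in the ranks, so the total rank alone controls the length of the walk.
\<close>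

lemma displacement_size_le:
  assumes t: "0 < t"
  shows "real (sum (displacement rs :: 'd::finite \<Rightarrow> nat) UNIV) \<le>
    real (length rs) * (t - t ^ CARD('d) / (real CARD('d) * t ^ (CARD('d) - 1)))
    + fact CARD('d) / (real CARD('d) * t ^ (CARD('d) - 1)) * real (sum_list rs)"
proof (induction rs)
  case (Cons r rs)
  let ?x = "real (sum (simplex_enum r :: 'd \<Rightarrow> nat) UNIV)" and ?c = "real CARD('d) * t ^ (CARD('d) - 1)"
  define a where "a = t - t ^ CARD('d) / ?c"
  define b where "b = fact CARD('d) / ?c"
  have c: "0 < ?c" using t by simp
  have "?x ^ CARD('d) \<le> fact CARD('d) * real r"
    using simplex_enum_size[of r, where 'd = 'd] by (metis of_nat_fact of_nat_le_iff of_nat_mult of_nat_power)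
  then have "(?x ^ CARD('d) - t ^ CARD('d)) / ?c \<le> (fact CARD('d) * real r - t ^ CARD('d)) / ?c"
    using c by (intro divide_right_mono) auto
  moreover have "?x \<le> t + (?x ^ CARD('d) - t ^ CARD('d)) / ?c"
    using t by (intro power_ge_tangent) (auto intro: sum_nonneg)
  ultimately have "?x \<le> a + b * real r"
    unfolding a_def b_def by (simp add: diff_divide_distrib)
  moreover have "real (sum (displacement rs :: 'd \<Rightarrow> nat) UNIV) \<le> real (length rs) * a + b * real (sum_list rs)"
    using Cons unfolding a_def b_def .
  moreover have "real (sum (displacement (r # rs) :: 'd \<Rightarrow> nat) UNIV)
      = ?x + real (sum (displacement rs :: 'd \<Rightarrow> nat) UNIV)" by (simp add: sum.distrib)
  ultimately show ?case unfolding a_def[symmetric] b_def[symmetric] by (simp add: algebra_simps)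
qed simp

text \<open>
  Within one round the Lipschitz bound leaves the surface at or above the closed probe, and it
  cannot pass through it.
\<close>

lemma lipschitz_above_greedy_end:
  assumes F: "lipschitz_fun F" "\<And>x. \<omega> (x, F x)" and \<eta>: "\<And>i. \<bar>\<eta> $ i\<bar> = 1"
  shows "\<omega> \<in> greedy_event \<eta> v rs \<Longrightarrow> snd v < F (fst v) \<Longrightarrow>
    snd (greedy_end \<eta> v rs) < F (fst (greedy_end \<eta> v rs))"
proof (induction rs arbitrary: v)
  case (Cons r rs)
  let ?u = "probe \<eta> v r"
  have "l1_norm (fst v - fst ?u) = int (sum (simplex_enum r :: 'a \<Rightarrow> nat) UNIV)"
    unfolding l1_norm_def probe_def tilt_def using \<eta> by (simp add: abs_mult)
  then have "snd ?u \<le> F (fst ?u)"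
    using lipschitz_l1_norm[OF F(1), of "fst v" "fst ?u"] Cons.prems(2) by (simp add: probe_def)
  moreover have "\<omega> ?u = False" using Cons.prems(1) by (simp add: greedy_event_Cons)
  then have "F (fst ?u) \<noteq> snd ?u" using F(2)[of "fst ?u"] by (metis prod.collapse)
  ultimately have "snd ?u < F (fst ?u)" by simp
  with Cons.IH[of ?u] Cons.prems(1) show ?case by (simp add: greedy_event_Cons)
qed simp

context
  fixes \<eta> :: "int ^ 'd::finite"
  assumes \<eta>: "\<And>i. \<bar>\<eta> $ i\<bar> = 1"
begin

lemma eta_square: "\<eta> $ i * (\<eta> $ i * x) = x"
proof -
  have "\<eta> $ i * \<eta> $ i = 1" using \<eta>[of i] by (metis abs_mult_self_eq mult_1)
  then show ?thesis by (metis mult.assoc mult_1)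
qed

lemma inner_tilt: "(\<Sum>i\<in>UNIV. \<eta> $ i * tilt \<eta> m $ i) = int (sum m UNIV)"
  by (simp add: tilt_def eta_square)

lemma l1_norm_tilt_diff: "l1_norm (tilt \<eta> m - tilt \<eta> m') = (\<Sum>i\<in>UNIV. \<bar>int (m i) - int (m' i)\<bar>)"
proof -
  have "\<bar>\<eta> $ i * int (m i) - \<eta> $ i * int (m' i)\<bar> = \<bar>int (m i) - int (m' i)\<bar>" for i
    using \<eta>[of i] by (metis abs_mult mult_1 right_diff_distrib)
  then show ?thesis by (simp add: l1_norm_def tilt_def)
qed

lemma layer_probe: "layer \<eta> (probe \<eta> v r) = layer \<eta> v + 1"
  using inner_tilt[of "simplex_enum r"]
  by (simp add: layer_def probe_def right_diff_distrib sum_subtractf)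

lemma inj_probe: "inj (probe \<eta> v)"
proof (rule injI)
  fix r r' assume "probe \<eta> v r = probe \<eta> v r'"
  then have "tilt \<eta> (simplex_enum r) = tilt \<eta> (simplex_enum r')" by (simp add: probe_def)
  then have "\<eta> $ i * int (simplex_enum r i) = \<eta> $ i * int (simplex_enum r' i)" for i
    by (simp add: tilt_def vec_eq_iff)
  moreover have "\<eta> $ i \<noteq> 0" for i using \<eta>[of i] by auto
  ultimately have "simplex_enum r = (simplex_enum r' :: 'd \<Rightarrow> nat)" by (intro ext) simp
  then show "r = r'" by (rule injD[OF inj_simplex_enum])
qed

lemma layer_probes:
  "u \<in> open_probes \<eta> v rs \<union> closed_probes \<eta> v rs \<Longrightarrow> layer \<eta> v < layer \<eta> u"
proof (induction rs arbitrary: v)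
  case (Cons r rs)
  then show ?case using Cons.IH[of "probe \<eta> v r"] layer_probe[of v] by fastforce
qed simp

lemma probes_disjoint_card:
  "open_probes \<eta> v rs \<inter> closed_probes \<eta> v rs = {} \<and>
   card (open_probes \<eta> v rs) = sum_list rs \<and> card (closed_probes \<eta> v rs) = length rs"
proof (induction rs arbitrary: v)
  case (Cons r rs)
  let ?u = "probe \<eta> v r"
  note IH = Cons.IH[of ?u]
  have later: "probe \<eta> v i \<notin> open_probes \<eta> ?u rs \<union> closed_probes \<eta> ?u rs" for i
    using layer_probes[of "probe \<eta> v i" ?u rs] layer_probe[of v] by fastforce
  have "?u \<notin> probe \<eta> v ` {..<r}" using inj_probe[of v] by (auto simp: inj_eq)
  then have "open_probes \<eta> v (r # rs) \<inter> closed_probes \<eta> v (r # rs) = {}"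
    using later IH by auto
  moreover have "card (probe \<eta> v ` {..<r}) = r"
    using card_image[OF inj_on_subset[OF inj_probe[of v] subset_UNIV]] by simp
  moreover have "card (open_probes \<eta> v (r # rs)) = card (probe \<eta> v ` {..<r}) + card (open_probes \<eta> ?u rs)"
    using later by (simp, subst card_Un_disjoint) auto
  moreover have "card (closed_probes \<eta> v (r # rs)) = length (r # rs)"
    using later[of r] IH by simp
  ultimately show ?case using IH by simp
qed simp

text \<open>
  The event prescribes the states of finitely many distinct sites.
\<close>

lemma greedy_event_prob:
  assumes "0 \<le> p" "p < 1"
  shows "measure (perc p) (greedy_event \<eta> v rs)
    = pmf (replicate_pmf (length rs) (geometric_pmf (1 - p))) rs"
  using perc_cylinder[OF finite_probes(1) finite_probes(2) _, of \<eta> v rs \<eta> v rs p]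
    probes_disjoint_card[of v rs] replicate_geometric_pmf[of "1 - p" rs] assms
  by (simp add: greedy_event_def)

text \<open>
  Rank lists of equal length exclude each other, since at the first difference one of them wants a
  probe closed and the other wants it open. So the ranks found by the greedy walk are distributed
  as independent geometric variables.
\<close>

lemma greedy_union_prob:
  assumes p: "0 \<le> p" "p < 1" and S: "\<And>rs. rs \<in> S \<Longrightarrow> length rs = k"
  shows "measure (perc p) (\<Union>rs\<in>S. greedy_event \<eta> v rs)
    = measure (replicate_pmf k (geometric_pmf (1 - p))) S"
proof -
  interpret prob_space "perc p :: 'd config measure" by (rule prob_space_perc)
  have disj: "disjoint_family_on (greedy_event \<eta> v) S"
    unfolding disjoint_family_on_def using greedy_events_disjoint S by blast
  have "emeasure (perc p) (\<Union>rs\<in>S. greedy_event \<eta> v rs)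
      = (\<integral>\<^sup>+rs. emeasure (perc p) (greedy_event \<eta> v rs) \<partial>count_space S)"
    by (intro emeasure_UN_countable disj) auto
  also have "\<dots> = (\<integral>\<^sup>+rs. ennreal (pmf (replicate_pmf k (geometric_pmf (1 - p))) rs) \<partial>count_space S)"
    using greedy_event_prob[OF p] S by (intro nn_integral_cong) (auto simp: emeasure_eq_measure)
  also have "\<dots> = emeasure (replicate_pmf k (geometric_pmf (1 - p))) S"
    by (rule nn_integral_pmf)
  finally show ?thesis by (simp add: measure_def)
qed

text \<open>
  The walk starts on the plane over \<open>tilt \<eta> u\<close> and ends within distance \<open>d j\<close> of the origin
  because \<open>u\<close> approximates its displacement. Its gain relative to the plane is the number of
  rounds minus \<open>1 - \<alpha>\<close> per diagonal step; replacing \<open>u\<close> by the displacement and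
  moving from the end point to the origin each cost at most \<open>d j\<close>, and rounding costs \<open>1\<close>.
\<close>

lemma lipschitz_high_at_origin:
  assumes F: "lipschitz_fun F" "\<And>x. \<omega> (x, F x)" "\<And>x. plane \<alpha> \<eta> x < F x"
    and \<alpha>: "0 \<le> \<alpha>" "\<alpha> < 1"
    and \<omega>: "\<omega> \<in> greedy_event \<eta> (tilt \<eta> u, plane \<alpha> \<eta> (tilt \<eta> u)) rs"
    and near: "\<And>i. u i \<le> displacement rs i" "\<And>i. displacement rs i \<le> u i + j"
  shows "real_of_int (F 0) > real (length rs) - (1 - \<alpha>) * real (sum (displacement rs :: 'd \<Rightarrow> nat) UNIV)
    - 2 * real CARD('d) * real j - 1"
proof -
  let ?M = "displacement rs :: 'd \<Rightarrow> nat" and ?v = "(tilt \<eta> u, plane \<alpha> \<eta> (tilt \<eta> u))"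
  let ?y = "fst (greedy_end \<eta> ?v rs)"
  have y: "?y = tilt \<eta> u - tilt \<eta> ?M" by (simp add: greedy_end_eq)
  have "snd (greedy_end \<eta> ?v rs) < F ?y"
    using F(3) by (intro lipschitz_above_greedy_end[OF F(1,2) \<eta> \<omega>]) simp
  then have 1: "plane \<alpha> \<eta> (tilt \<eta> u) + int (length rs) - int (sum ?M UNIV) < F ?y"
    by (simp add: greedy_end_eq)
  have "\<bar>int (u i) - int (?M i)\<bar> = int (?M i) - int (u i)" for i using near(1)[of i] by simp
  then have "l1_norm (?y - 0) = (\<Sum>i\<in>UNIV. int (?M i) - int (u i))"
    unfolding y using l1_norm_tilt_diff[of u ?M] by simp
  also have "\<dots> \<le> (\<Sum>i\<in>(UNIV :: 'd set). int j)"
    using near(2) by (intro sum_mono) (simp add: add.commute le_diff_eq diff_le_eq flip: of_nat_add)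
  finally have l1: "l1_norm (?y - 0) \<le> int CARD('d) * int j" by simp
  have 2: "F ?y - F 0 \<le> int CARD('d) * int j"
    using lipschitz_l1_norm[OF F(1), of ?y 0] l1 by linarith
  have "sum ?M UNIV \<le> (\<Sum>i\<in>UNIV. u i + j)" using near(2) by (intro sum_mono)
  then have "sum ?M UNIV \<le> sum u UNIV + CARD('d) * j" by (simp add: sum.distrib)
  then have "real (sum ?M UNIV) \<le> real (sum u UNIV + CARD('d) * j)" by (simp only: of_nat_le_iff)
  then have "real (sum ?M UNIV) \<le> real (sum u UNIV) + real CARD('d) * real j" by simp
  then have "\<alpha> * real (sum ?M UNIV) \<le> \<alpha> * (real (sum u UNIV) + real CARD('d) * real j)"
    using \<alpha> by (intro mult_left_mono)
  moreover have "\<alpha> * (real CARD('d) * real j) \<le> 1 * (real CARD('d) * real j)"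
    using \<alpha> by (intro mult_right_mono) auto
  moreover have "real_of_int (plane \<alpha> \<eta> (tilt \<eta> u)) > \<alpha> * real (sum u UNIV) - 1"
    unfolding plane_def inner_tilt by simp
  moreover have "real_of_int (plane \<alpha> \<eta> (tilt \<eta> u)) + real (length rs) - real (sum ?M UNIV) 
      < real_of_int (F 0) + real CARD('d) * real j"
  proof -
    have "plane \<alpha> \<eta> (tilt \<eta> u) + int (length rs) - int (sum ?M UNIV) < F 0 + int CARD('d) * int j"
      using 1 2 by linarith
    then have "real_of_int (plane \<alpha> \<eta> (tilt \<eta> u) + int (length rs) - int (sum ?M UNIV))
      < real_of_int (F 0 + int CARD('d) * int j)" by (simp only: of_int_less_iff)
    then show ?thesis by simp
  qed
  ultimately show ?thesis by (simp add: algebra_simps)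
qed

text \<open>
  The walk makes \<open>K j\<close> rounds. On an event of probability bounded below, its displacement has
  length at most \<open>K j m\<close> with \<open>(1 - \<alpha>) m < 1\<close>. It then lies in one of a number of boxes of side
  \<open>j\<close> that does not depend on \<open>j\<close>, and one of them has at least its share of the probability.
  Starting from the corner of that box brings the end close to the origin, and for large \<open>K\<close> the
  gain \<open>K j (1 - (1 - \<alpha>) m)\<close> exceeds the correction \<open>2 d j\<close>.
\<close>

lemma greedy_events_push_up:
  assumes \<alpha>: "0 \<le> \<alpha>" "\<alpha> < 1" and p: "0 \<le> p" "p < 1"
    and sub: "fact CARD('d) * (1 - \<alpha>) ^ CARD('d) * p < 1 - p"
  shows "\<exists>\<delta>>0. \<forall>j. \<exists>C\<in>sets (perc p). \<delta> \<le> measure (perc p) C \<and>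
    (\<forall>\<omega>\<in>C. \<forall>F. lipschitz_fun F \<longrightarrow> (\<forall>x. \<omega> (x, F x) \<and> F x > plane \<alpha> \<eta> x) \<longrightarrow> int j \<le> F 0)"
proof -
  let ?d = "CARD('d)"
  define t where "t = 1 / (1 - \<alpha>)"
  have t: "0 < t" and t1: "(1 - \<alpha>) * t = 1" using \<alpha> by (auto simp: t_def)
  have "p / (1 - p) < t ^ ?d / fact ?d"
    using sub p \<alpha> unfolding t_def by (simp add: field_simps)
  \<comment> \<open>The strict first inequality leaves room for Markov's inequality, the second for a gain.\<close>
  then obtain s where s: "p / (1 - p) < s" "s < t ^ ?d / fact ?d" using dense by blast
  have "0 \<le> p / (1 - p)" using p by simp
  with s have s0: "0 < s" by linarith
  define c where "c = real ?d * t ^ (?d - 1)"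
  have c: "0 < c" unfolding c_def using t by simp
  \<comment> \<open>The tangent bound on the length of a round at rank \<open>s\<close>. It is less than \<open>t\<close>, the number
    of diagonal steps that one step up repays, because \<open>d! s < t ^ d\<close>.\<close>
  define m where "m = t - t ^ ?d / c + fact ?d / c * s"
  have "fact ?d * s < t ^ ?d" using s(2) by (simp add: field_simps)
  then have "fact ?d * s / c < t ^ ?d / c" using c by (rule divide_strict_right_mono)
  then have "m < t" unfolding m_def by simp
  then have "(1 - \<alpha>) * m < (1 - \<alpha>) * t" using \<alpha> by simp
  then have gain: "0 < 1 - (1 - \<alpha>) * m" using t1 by simp
  obtain K where K: "(2 * real ?d + 1) / (1 - (1 - \<alpha>) * m) \<le> real K" using real_arch_simple by blast
  then have K': "2 * real ?d + 1 \<le> real K * (1 - (1 - \<alpha>) * m)"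
    using gain by (simp add: pos_divide_le_eq)
  have "K \<noteq> 0" using K' by (intro notI) simp
  then have K0: "0 < K" by simp
  define B where "B = nat \<lfloor>real K * m\<rfloor>"
  define U where "U = (\<Pi>\<^sub>E i\<in>(UNIV :: 'd set). {..B})"
  have U: "finite U" unfolding U_def by (intro finite_PiE) auto
  have "(\<lambda>i. 0) \<in> U" unfolding U_def by (simp add: PiE_iff)
  then have U0: "0 < card U" using U by (auto simp: card_gt_0_iff)
  define \<delta> where "\<delta> = (1 - p / (1 - p) / s) / real (card U)"
  have "p / (1 - p) / s < 1" by (metis mult_1 s(1) pos_divide_less_eq s0)
  then have \<delta>0: "0 < 1 - p / (1 - p) / s" by simp
  have ex: "\<exists>C\<in>sets (perc p). \<delta> \<le> measure (perc p) C \<and>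
    (\<forall>\<omega>\<in>C. \<forall>F. lipschitz_fun F \<longrightarrow> (\<forall>x. \<omega> (x, F x) \<and> F x > plane \<alpha> \<eta> x) \<longrightarrow> int j \<le> F 0)"
    if j: "0 < j" for j :: nat
  proof -
    let ?k = "K * j"
    let ?Q = "measure_pmf (replicate_pmf ?k (geometric_pmf (1 - p)))"
    define G where "G = {rs :: nat list. length rs = ?k \<and> real (sum_list rs) \<le> real ?k * s}"
    define box where "box rs = (\<lambda>i :: 'd. displacement rs i div j)" for rs
    define S where "S u = {rs \<in> G. box rs = u}" for u
    have G_prob: "1 - p / (1 - p) / s \<le> measure ?Q G"
      using replicate_geometric_markov[of "1 - p" s ?k] p s0 K0 j unfolding G_def by simp
    have size: "real (sum (displacement rs :: 'd \<Rightarrow> nat) UNIV) \<le> real ?k * m" if "rs \<in> G" for rs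
    proof -
      have "real (sum (displacement rs :: 'd \<Rightarrow> nat) UNIV)
          \<le> real ?k * (t - t ^ ?d / c) + fact ?d / c * real (sum_list rs)"
        using displacement_size_le[OF t, of rs, where 'd = 'd] that unfolding G_def c_def by simp
      also have "\<dots> \<le> real ?k * (t - t ^ ?d / c) + fact ?d / c * (real ?k * s)"
        using that c unfolding G_def by (intro add_left_mono mult_left_mono) auto
      finally show ?thesis unfolding m_def by (simp add: algebra_simps)
    qed
    have box_U: "box rs \<in> U" if "rs \<in> G" for rs
    proof -
      have "box rs i \<le> B" for i
      proof -
        have "displacement rs i \<le> sum (displacement rs :: 'd \<Rightarrow> nat) UNIV" by (rule member_le_sum) auto
        then have "real (displacement rs i) \<le> real ?k * m" using size[OF that] by linarith
        then have le: "real (displacement rs i) \<le> real K * m * real j" by (simp add: mult_ac)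
        have "box rs i * j \<le> displacement rs i" unfolding box_def by (rule div_times_less_eq_dividend)
        then have "real (box rs i) * real j \<le> real (displacement rs i)" by (metis of_nat_le_iff of_nat_mult)
        with le have "real (box rs i) * real j \<le> real K * m * real j" by linarith
        then have "real (box rs i) \<le> real K * m" using j by simp
        then show ?thesis unfolding B_def by linarith
      qed
      then show ?thesis unfolding U_def by auto
    qed
    have "\<exists>u\<in>U. \<delta> \<le> measure ?Q (S u)"
    proof (rule ccontr)
      assume "\<not> ?thesis"
      then have small: "measure ?Q (S u) < \<delta>" if "u \<in> U" for u using that by auto
      have "G = (\<Union>u\<in>U. S u)" unfolding S_def using box_U by auto
      then have "measure ?Q G \<le> (\<Sum>u\<in>U. measure ?Q (S u))"
        using U by (metis measure_UNION_le sets_measure_pmf UNIV_I)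
      also have "\<dots> < (\<Sum>u\<in>U. \<delta>)" using U U0 small by (intro sum_strict_mono) auto
      also have "\<dots> = 1 - p / (1 - p) / s" using U0 by (simp add: \<delta>_def)
      finally show False using G_prob by simp
    qed
    then obtain u where u: "u \<in> U" "\<delta> \<le> measure ?Q (S u)" by blast
    \<comment> \<open>The corner of the chosen box.\<close>
    define u' where "u' i = j * u i" for i
    let ?v = "(tilt \<eta> u', plane \<alpha> \<eta> (tilt \<eta> u'))"
    let ?C = "\<Union>rs\<in>S u. greedy_event \<eta> ?v rs"
    have "\<delta> \<le> measure (perc p) ?C"
      using greedy_union_prob[OF p, of "S u" ?k ?v] u(2) unfolding S_def G_def by simp
    moreover have "?C \<in> sets (perc p)" by (intro sets.countable_UN') auto
    moreover have "int j \<le> F 0"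
      if \<omega>: "\<omega> \<in> ?C" and F: "lipschitz_fun F" "\<forall>x. \<omega> (x, F x) \<and> F x > plane \<alpha> \<eta> x" for \<omega> F
    proof -
      from \<omega> obtain rs where rs: "rs \<in> G" "box rs = u" and ev: "\<omega> \<in> greedy_event \<eta> ?v rs"
        unfolding S_def by auto
      have near: "u' i \<le> displacement rs i" "displacement rs i \<le> u' i + j" for i
      proof -
        have "u' i = j * (displacement rs i div j)" unfolding u'_def rs(2)[symmetric] box_def ..
        then have "displacement rs i = u' i + displacement rs i mod j" by simp
        moreover have "displacement rs i mod j < j" using j by simp
        ultimately show "u' i \<le> displacement rs i" "displacement rs i \<le> u' i + j" by linarith+
      qed
      have "real_of_int (F 0) > real (length rs) - (1 - \<alpha>) * real (sum (displacement rs :: 'd \<Rightarrow> nat) UNIV)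
          - 2 * real ?d * real j - 1"
        using F by (intro lipschitz_high_at_origin[OF _ _ _ \<alpha> ev near]) auto
      moreover have "(1 - \<alpha>) * real (sum (displacement rs :: 'd \<Rightarrow> nat) UNIV) \<le> (1 - \<alpha>) * (real ?k * m)"
        using \<alpha> size[OF rs(1)] by (intro mult_left_mono) auto
      moreover have "real (length rs) = real K * real j" using rs(1) unfolding G_def by simp
      moreover have "(2 * real ?d + 1) * real j \<le> real K * (1 - (1 - \<alpha>) * m) * real j"
        using K' by (intro mult_right_mono) auto
      ultimately have "real j - 1 < real_of_int (F 0)" by (simp add: algebra_simps)
      then show ?thesis by linarith
    qed
    ultimately show ?thesis by blast
  qed
  show ?thesis
  proof (intro exI conjI allI)
    show "0 < \<delta>" unfolding \<delta>_def using \<delta>0 U0 by simp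
    fix j
    obtain C where "C \<in> sets (perc p)" "\<delta> \<le> measure (perc p) C"
      "\<forall>\<omega>\<in>C. \<forall>F. lipschitz_fun F \<longrightarrow> (\<forall>x. \<omega> (x, F x) \<and> F x > plane \<alpha> \<eta> x) \<longrightarrow> int (Suc j) \<le> F 0"
      using ex[of "Suc j"] by auto
    then show "\<exists>C\<in>sets (perc p). \<delta> \<le> measure (perc p) C \<and>
        (\<forall>\<omega>\<in>C. \<forall>F. lipschitz_fun F \<longrightarrow> (\<forall>x. \<omega> (x, F x) \<and> F x > plane \<alpha> \<eta> x) \<longrightarrow> int j \<le> F 0)"
      by (intro bexI[of _ C] conjI) fastforce+
  qed
qed

text \<open>
  With positive probability, infinitely many of the events of the previous lemma occur, and then
  no surface can have a finite height over the origin. By the zero-one law, a surface exists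
  with probability zero.
\<close>

theorem subcritical:
  assumes \<alpha>: "0 \<le> \<alpha>" "\<alpha> < 1" and p: "0 \<le> p" "p < 1"
    and sub: "fact CARD('d) * (1 - \<alpha>) ^ CARD('d) * p < 1 - p"
  shows "measure (perc p) (lip_above (plane \<alpha> \<eta>)) = 0"
proof -
  interpret prob_space "perc p :: 'd config measure" by (rule prob_space_perc)
  let ?L = "lip_above (plane \<alpha> \<eta>)"
  obtain \<delta> C where \<delta>: "0 < \<delta>" and C: "\<And>j. C j \<in> events" "\<And>j :: nat. \<delta> \<le> prob (C j)"
    and high: "\<And>j \<omega> F. \<omega> \<in> C j \<Longrightarrow> lipschitz_fun F \<Longrightarrow> (\<forall>x. \<omega> (x, F x) \<and> F x > plane \<alpha> \<eta> x) \<Longrightarrow> int j \<le> F 0"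
    using greedy_events_push_up[OF \<alpha> p sub] by metis
  define D where "D n = (\<Union>j\<in>{n..}. C j)" for n
  have D: "D n \<in> events" for n unfolding D_def using C(1) by (intro sets.countable_UN') auto
  have "decseq D" unfolding D_def decseq_def by (intro allI impI UN_mono) auto
  then have "(\<lambda>n. prob (D n)) \<longlonglongrightarrow> prob (\<Inter>n. D n)"
    using D by (intro finite_Lim_measure_decseq) auto
  moreover have "\<delta> \<le> prob (D n)" for n
  proof -
    have "prob (C n) \<le> prob (D n)" using D by (intro finite_measure_mono) (auto simp: D_def)
    then show ?thesis using C(2)[of n] by linarith
  qed
  ultimately have lim: "\<delta> \<le> prob (\<Inter>n. D n)" by (intro LIMSEQ_le_const) auto
  have "?L \<inter> (\<Inter>n. D n) = {}"
  proof (rule ccontr)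
    assume "\<not> ?thesis"
    then obtain \<omega> where \<omega>: "\<omega> \<in> ?L" "\<omega> \<in> (\<Inter>n. D n)" by auto
    obtain F where F: "lipschitz_fun F" "\<forall>x. \<omega> (x, F x) \<and> F x > plane \<alpha> \<eta> x"
      using \<omega>(1) unfolding lip_above_def by auto
    obtain j where "j \<ge> nat (F 0 + 1)" "\<omega> \<in> C j" using \<omega>(2) unfolding D_def by fastforce
    with high[OF this(2) F] show False by linarith
  qed
  then have "prob ?L + prob (\<Inter>n. D n) = prob (?L \<union> (\<Inter>n. D n))"
    using D by (intro finite_measure_Union[symmetric]) auto
  also have "\<dots> \<le> 1" by (rule prob_le_1)
  finally have "prob ?L < 1" using lim \<delta> by linarith
  then show ?thesis using lip_above_zero_one[of p "plane \<alpha> \<eta>"] p by simp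
qed

end

section \<open>The critical probability\<close>

lemma is_critical_unique:
  assumes "is_critical \<alpha> \<eta> c" "is_critical \<alpha> \<eta> c'"
  shows "c = c'"
proof -
  have "\<not> a < b" if "is_critical \<alpha> \<eta> a" "is_critical \<alpha> \<eta> b" for a b
  proof
    assume "a < b"
    then obtain p where "a < p" "p < b" using dense by blast
    moreover from this that have "p \<in> {0..1}" unfolding is_critical_def by auto
    ultimately show False using that unfolding is_critical_def by force
  qed
  then show ?thesis using assms by (meson linorder_neqE_linordered_idom)
qed

text \<open>
  The infimum of the densities at which the event has probability one is critical: it is below
  \<open>1\<close> by \<open>supercritical_exists\<close>, and it is at least \<open>l\<close>, hence positive. The zero-one law
  and monotonicity give the two regimes.
\<close>

lemma p_L_ge:
  fixes \<eta> :: "int ^ 'd::finite"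
  assumes \<eta>: "\<And>i. \<eta> $ i \<in> {-1, 0, 1}" and \<alpha>: "0 \<le> \<alpha>" "\<alpha> < 1" and l: "0 < l"
    and sub: "\<And>p. 0 \<le> p \<Longrightarrow> p < l \<Longrightarrow> measure (perc p) (LIP \<alpha> \<eta>) = 0"
  shows "l \<le> p_L \<alpha> \<eta>"
proof -
  define T where "T = {p. 0 \<le> p \<and> p \<le> 1 \<and> measure (perc p) (LIP \<alpha> \<eta>) = 1}"
  define c where "c = Inf T"
  obtain p1 where p1: "0 \<le> p1" "p1 < 1" "measure (perc p1) (LIP \<alpha> \<eta>) = 1"
    using supercritical_exists[OF \<eta> \<alpha>] unfolding LIP_eq_lip_above by blast
  then have T: "p1 \<in> T" unfolding T_def by simp
  have bdd: "bdd_below T" unfolding T_def by (auto intro: bdd_belowI)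
  have "l \<le> p" if "p \<in> T" for p
    using that sub[of p] unfolding T_def by (cases "p < l") auto
  then have lc: "l \<le> c" unfolding c_def using T by (intro cInf_greatest) auto
  have "c \<le> p1" unfolding c_def using T bdd by (rule cInf_lower)
  then have c1: "c < 1" using p1 by simp
  have below: "measure (perc p) (LIP \<alpha> \<eta>) = 0" if "p \<in> {0..1}" "p < c" for p
  proof -
    have "p \<notin> T" using that(2) bdd unfolding c_def by (meson cInf_lower not_le)
    then have "measure (perc p) (LIP \<alpha> \<eta>) \<noteq> 1" using that(1) unfolding T_def by auto
    then show ?thesis
      using lip_above_zero_one[of p "plane \<alpha> \<eta>"] that(1) unfolding LIP_eq_lip_above by auto
  qed
  have above: "measure (perc p) (LIP \<alpha> \<eta>) = 1" if "p \<in> {0..1}" and cp: "c < p" for p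
  proof -
    obtain p' where p': "p' \<in> T" "p' < p"
      using cp T unfolding c_def by (metis cInf_lessD empty_iff)
    then have "1 \<le> measure (perc p) (LIP \<alpha> \<eta>)"
      using lip_above_mono[of p' p "plane \<alpha> \<eta>"] that(1) unfolding LIP_eq_lip_above T_def by auto
    then show ?thesis
      using lip_above_zero_one[of p "plane \<alpha> \<eta>"] that(1) unfolding LIP_eq_lip_above by auto
  qed
  have crit: "is_critical \<alpha> \<eta> c" unfolding is_critical_def using l lc c1 below above by auto
  then have "p_L \<alpha> \<eta> = c" unfolding p_L_def using is_critical_unique by (intro the_equality) auto
  with lc show ?thesis by simp
qed

theorem proposition3p7:
  fixes \<alpha> :: real and \<eta> :: "int ^ 'd::finite"
  assumes "0 \<le> \<alpha>" and "\<alpha> < 1"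
    and "\<And>i. \<eta> $ i \<in> {-1, 0, 1}"
    and "l1_norm \<eta> = int CARD('d)"
  shows "q_L \<alpha> \<eta> \<le> fact CARD('d) * (1 - \<alpha>) ^ CARD('d)
                       / (1 + fact CARD('d) * (1 - \<alpha>) ^ CARD('d))
       \<and> fact CARD('d) * (1 - \<alpha>) ^ CARD('d) / (1 + fact CARD('d) * (1 - \<alpha>) ^ CARD('d))
           \<le> fact CARD('d) * (1 - \<alpha>) ^ CARD('d)"
proof -
  define a where "a = fact CARD('d) * (1 - \<alpha>) ^ CARD('d)"
  have a: "0 < a" using assms(2) by (simp add: a_def)
  have \<eta>: "\<bar>\<eta> $ i\<bar> = 1" for i
  proof -
    have le: "\<bar>\<eta> $ j\<bar> \<le> 1" for j using assms(3)[of j] by auto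
    have "(\<Sum>j\<in>UNIV. 1 - \<bar>\<eta> $ j\<bar>) = 0"
      using assms(4) by (simp add: l1_norm_def sum_subtractf)
    then have "\<forall>j\<in>UNIV. 1 - \<bar>\<eta> $ j\<bar> = 0" using le by (subst (asm) sum_nonneg_eq_0_iff) auto
    then show ?thesis by simp
  qed
  have "measure (perc p) (LIP \<alpha> \<eta>) = 0" if "0 \<le> p" "p < 1 / (1 + a)" for p
  proof -
    have "p * (1 + a) < 1" using that(2) a by (simp add: pos_less_divide_eq)
    then have "a * p < 1 - p" by (simp add: algebra_simps)
    moreover from this have "p < 1" using mult_nonneg_nonneg[of a p] a that(1) by linarith
    ultimately show ?thesis
      using subcritical[OF \<eta> assms(1,2) that(1)] unfolding LIP_eq_lip_above a_def by simp
  qed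
  then have "1 / (1 + a) \<le> p_L \<alpha> \<eta>" using a by (intro p_L_ge[OF assms(3,1,2)]) auto
  moreover have "1 - 1 / (1 + a) = a / (1 + a)" using a by (simp add: field_simps)
  ultimately have "q_L \<alpha> \<eta> \<le> a / (1 + a)" unfolding q_L_def by linarith
  moreover have "a / (1 + a) \<le> a" using a by (simp add: pos_divide_le_eq algebra_simps)
  ultimately show ?thesis unfolding a_def by simp
qed

end
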